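(* Let $n\ge 1$, $V=\{1,\dots,n\}$, and let $\tau$ be an arbitrary permutation of $V$, with decomposition $\tau=\tau_1\cdots\tau_k$ into disjoint cycles (fixed points counted as cycles of length $1$); let $m_j=|\tau_j|$ be the length of $\tau_j$, so $m_1+\dots+m_k=n$. Equip $\mathbb{Z}^n$ (maps $V\to\mathbb{Z}$) with the multiplication $$(a*b)_i=a_i+b_{\tau^{a_i}(i)},\qquad i=1,\dots,n,$$ and let $\mathfrak{T}_n^\tau$ be the group of invertible elements of the monoid $(\mathbb{Z}^n,* )$. Then: (1) the points of $\mathfrak{T}_n^\tau\subset\mathbb{Z}^n\subset\mathbb{R}^n$ are exactly the vertices of a tessellation of $\mathbb{R}^n$ by translates of a single polytope congruent to $\Pi_{m_1-1}\times\dots\times\Pi_{m_k-1}\times I^k$, where $\Pi_i$ denotes the $i$-dimensional permutohedron and $I$ a segment (i.e. a product of prisms $\Pi_{m_j-1}\times I$ with permutohedron bases); (2) $\mathfrak{T}_n^\tau\cong(\mathbb{Z}^{m_1}\rtimes S_{m_1})\times\dots\times(\mathbb{Z}^{m_k}\rtimes S_{m_k})$, where in each factor $S_{m_j}$ acts on $\mathbb{Z}^{m_j}$ by permuting coordinates.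
   Context: The multiplication $*$ is induced by the right action $v\cdot k=\tau^k(v)$ of $\mathbb{Z}$ on $V$ via $(\phi_2*\phi_1)(v)=\phi_2(v)+\phi_1(v\cdot\phi_2(v))$; it is associative with identity $(0,\dots,0)$. The $i$-dimensional permutohedron $\Pi_i\subset\mathbb{R}^{i+1}$ is the convex hull of all points obtained by permuting the coordinates of $(1,2,\dots,i+1)$; the prism $\Pi_{m-1}\times I$ can be realized as $\mathrm{conv}\big(\Pi_{m-1}\cup(\Pi_{m-1}+(1,\dots,1))\big)\subset\mathbb{R}^m$. A tessellation means the tiles cover $\mathbb{R}^n$ and have pairwise disjoint interiors. *)

theory Defs
  imports
    "HOL-Analysis.Analysis"
    "HOL-Analysis.Finite_Function_Topology"
    "HOL-Combinatorics.Cycles"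
    "HOL-Algebra.Elementary_Groups"
    "HOL-Algebra.Product_Groups"
    "HOL-Algebra.Sym_Groups"
begin

section \<open>The twisted monoid on integer vectors and its group of units\<close>

definition perm_power :: "('a \<Rightarrow> 'a) \<Rightarrow> int \<Rightarrow> 'a \<Rightarrow> 'a" where
  "perm_power \<tau> a = (if 0 \<le> a then \<tau> ^^ nat a else (inv_into UNIV \<tau>) ^^ nat (- a))"

definition twisted_monoid :: "('n::finite \<Rightarrow> 'n) \<Rightarrow> (int ^ 'n) monoid" where
  "twisted_monoid \<tau> =
     \<lparr>carrier = UNIV,
      monoid.mult = (\<lambda>a b. \<chi> i. a $ i + b $ (perm_power \<tau> (a $ i) i)),
      one = 0\<rparr>"

definition twisted_group :: "('n::finite \<Rightarrow> 'n) \<Rightarrow> (int ^ 'n) monoid" where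
  "twisted_group \<tau> = units_of (twisted_monoid \<tau>)"

definition real_vec :: "int ^ 'n \<Rightarrow> real ^ 'n" where
  "real_vec a = (\<chi> i. real_of_int (a $ i))"

lemma perm_power_0 [simp]: "perm_power \<tau> 0 = id"
  by (simp add: perm_power_def)

lemma perm_power_Suc:
  assumes "bij \<tau>"
  shows "perm_power \<tau> (a + 1) x = perm_power \<tau> a (\<tau> x)"
proof (cases "0 \<le> a")
  case True
  then have "nat (a + 1) = Suc (nat a)"
    by simp
  then show ?thesis
    using True by (simp add: perm_power_def funpow_swap1)
next
  case False
  define m where "m = nat (- a - 1)"
  have a: "nat (- a) = Suc m" "nat (- (a + 1)) = m"
    using False by (auto simp: m_def)
  have "(inv_into UNIV \<tau> ^^ Suc m) (\<tau> x) = (inv_into UNIV \<tau> ^^ m) x"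
    using assms by (simp add: funpow_swap1 bij_is_inj)
  then show ?thesis
    using False a by (cases "a = - 1") (auto simp: perm_power_def m_def)
qed

lemma perm_power_add:
  assumes "bij \<tau>"
  shows "perm_power \<tau> (a + b) x = perm_power \<tau> b (perm_power \<tau> a x)"
proof (induction a arbitrary: x rule: int_induct[where k = 0])
  case base
  then show ?case by simp
next
  case (step1 i)
  have "perm_power \<tau> (i + 1 + b) x = perm_power \<tau> (i + b) (\<tau> x)"
    using perm_power_Suc[OF assms, of "i + b"] by (simp add: ac_simps)
  then show ?case
    using step1 perm_power_Suc[OF assms] by simp
next
  case (step2 i)
  obtain y where y: "x = \<tau> y"
    using assms by (metis bij_pointE)
  have "perm_power \<tau> (i - 1 + b) x = perm_power \<tau> (i + b) y"
    using perm_power_Suc[OF assms, of "i - 1 + b"] y by simp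
  moreover have "perm_power \<tau> (i - 1) x = perm_power \<tau> i y"
    using perm_power_Suc[OF assms, of "i - 1"] y by simp
  ultimately show ?case
    using step2 by simp
qed

lemma monoid_twisted_monoid:
  assumes "\<tau> permutes UNIV"
  shows "Group.monoid (twisted_monoid \<tau>)"
  by (rule Group.monoidI)
    (auto simp: twisted_monoid_def vec_eq_iff perm_power_add[OF permutes_bij[OF assms]])

section \<open>Decomposition of a permutation into disjoint cycles\<close>

text \<open>
  Cycles are listed as in \<open>cycle_of_list\<close>; singleton lists stand for fixed points, so the lists
  together contain every element exactly once.
\<close>

definition disjoint_cycle_decomposition :: "('a \<Rightarrow> 'a) \<Rightarrow> 'a list list \<Rightarrow> bool" where
  "disjoint_cycle_decomposition \<tau> cs \<longleftrightarrow>
     [] \<notin> set cs \<and> distinct (concat cs) \<and> set (concat cs) = UNIV \<and>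
     \<tau> = foldr (\<circ>) (map cycle_of_list cs) id"

lemma ex_disjoint_cycle_decomposition:
  fixes \<tau> :: "'a::finite \<Rightarrow> 'a"
  assumes "\<tau> permutes UNIV"
  shows "\<exists>cs. disjoint_cycle_decomposition \<tau> cs"
proof -
  have "cycle_decomp UNIV \<tau>"
    using assms by (simp add: cycle_decomposition)
  moreover have "\<exists>cs. [] \<notin> set cs \<and> distinct (concat cs) \<and> set (concat cs) = I \<and>
      p = foldr (\<circ>) (map cycle_of_list cs) id" if "cycle_decomp I p" for I and p :: "'a \<Rightarrow> 'a"
    using that
  proof (induction rule: cycle_decomp.induct)
    case empty
    show ?case by (rule exI[of _ "[]"]) simp
  next
    case (comp I p c)
    then obtain cs where cs: "[] \<notin> set cs" "distinct (concat cs)" "set (concat cs) = I"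
      "p = foldr (\<circ>) (map cycle_of_list cs) id" by blast
    show ?case
    proof (cases "c = []")
      case True
      then have "cycle_of_list c \<circ> p = p" "set c \<union> I = I"
        by (simp_all only: cycle_of_list.simps id_comp list.set Un_empty_left)
      then show ?thesis using cs by metis
    next
      case False
      have "cycle_of_list c \<circ> p = foldr (\<circ>) (map cycle_of_list (c # cs)) id"
        by (simp only: cs(4) list.map foldr.simps o_apply)
      moreover have "[] \<notin> set (c # cs) \<and> distinct (concat (c # cs)) \<and> set (concat (c # cs)) = set c \<union> I"
        using False cs(1-3) comp.hyps by auto
      ultimately show ?thesis by blast
    qed
  qed
  ultimately show ?thesis
    unfolding disjoint_cycle_decomposition_def by blast
qed

section \<open>Products of prisms over permutohedra\<close>

text \<open>
  Since the dimensions of the factors vary, \<open>\<real>\<^sup>m\<close> is represented by the finitely supported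
  functions \<open>nat \<Rightarrow>\<^sub>0 real\<close> supported in \<open>{1..m}\<close>. The library norm on this type is
  not Euclidean (it is the sum of absolute values) and is not used: distances are given by
  \<open>prism_product_dist\<close>.
\<close>

definition permutohedron :: "nat \<Rightarrow> (nat \<Rightarrow>\<^sub>0 real) set" where
  "permutohedron d = convex hull
     {x. \<exists>p. p permutes {1..d + 1} \<and>
         (\<forall>i. Poly_Mapping.lookup x i = (if i \<in> {1..d + 1} then real (p i) else 0))}"

text \<open>
  The product of the prisms \<open>\<Pi>\<^bsub>m - 1\<^esub> \<times> I\<close>, where \<open>m\<close> runs through the list \<open>ms\<close> of positive
  numbers and the segment in the \<open>j\<close>-th prism has length \<open>l j\<close>; with the Euclidean distance of
  the ambient space, whose dimension is \<open>sum_list ms + length ms\<close>.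
\<close>

definition prism_product :: "nat list \<Rightarrow> (nat \<Rightarrow> real) \<Rightarrow> (nat \<Rightarrow> (nat \<Rightarrow>\<^sub>0 real) \<times> real) set" where
  "prism_product ms l = (\<Pi>\<^sub>E j\<in>{..<length ms}. permutohedron (ms ! j - 1) \<times> {0..l j})"

definition prism_product_dist ::
  "nat list \<Rightarrow> (nat \<Rightarrow> (nat \<Rightarrow>\<^sub>0 real) \<times> real) \<Rightarrow> (nat \<Rightarrow> (nat \<Rightarrow>\<^sub>0 real) \<times> real) \<Rightarrow> real" where
  "prism_product_dist ms x y =
     sqrt (\<Sum>j<length ms.
       (\<Sum>i = 1..ms ! j. (Poly_Mapping.lookup (fst (x j)) i - Poly_Mapping.lookup (fst (y j)) i)\<^sup>2)
       + (snd (x j) - snd (y j))\<^sup>2)"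

definition congruent_to_prism_product ::
  "'a::metric_space set \<Rightarrow> nat list \<Rightarrow> (nat \<Rightarrow> real) \<Rightarrow> bool" where
  "congruent_to_prism_product P ms l \<longleftrightarrow>
     (\<exists>f. bij_betw f P (prism_product ms l) \<and>
          (\<forall>x\<in>P. \<forall>y\<in>P. prism_product_dist ms (f x) (f y) = dist x y))"

section \<open>Tessellations\<close>

definition tessellation :: "'a::euclidean_space set set \<Rightarrow> bool" where
  "tessellation \<T> \<longleftrightarrow>
     \<Union>\<T> = UNIV \<and> pairwise (\<lambda>A B. interior A \<inter> interior B = {}) \<T>"

definition tessellation_vertices :: "'a::euclidean_space set set \<Rightarrow> 'a set" where
  "tessellation_vertices \<T> = {v. \<exists>A\<in>\<T>. v extreme_point_of A}"

definition translates :: "'a::euclidean_space set \<Rightarrow> 'a set \<Rightarrow> 'a set set" where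
  "translates P L = (\<lambda>t. (+) t ` P) ` L"

section \<open>Semidirect products\<close>

definition semidirect_product ::
  "('a, 'c) monoid_scheme \<Rightarrow> ('b, 'd) monoid_scheme \<Rightarrow> ('b \<Rightarrow> 'a \<Rightarrow> 'a) \<Rightarrow> ('a \<times> 'b) monoid" where
  "semidirect_product N H \<phi> =
     \<lparr>carrier = carrier N \<times> carrier H,
      monoid.mult = (\<lambda>(x, g) (y, h). (x \<otimes>\<^bsub>N\<^esub> \<phi> g y, g \<otimes>\<^bsub>H\<^esub> h)),
      one = (\<one>\<^bsub>N\<^esub>, \<one>\<^bsub>H\<^esub>)\<rparr>"

definition permute_coords :: "nat \<Rightarrow> (nat \<Rightarrow> nat) \<Rightarrow> (nat \<Rightarrow> int) \<Rightarrow> nat \<Rightarrow> int" where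
  "permute_coords m \<sigma> x = (\<lambda>i\<in>{1..m}. x (inv_into UNIV \<sigma> i))"

definition int_semidirect_sym :: "nat \<Rightarrow> ((nat \<Rightarrow> int) \<times> (nat \<Rightarrow> nat)) monoid" where
  "int_semidirect_sym m =
     semidirect_product (product_group {1..m} (\<lambda>_. integer_group)) (sym_group m) (permute_coords m)"

end

(*
  Write p for the position of an element on its cycle, of length m. An integer vector a is
  invertible iff on every cycle the numbers p + a_p are pairwise incongruent modulo m. Let L be
  the lattice of the integer vectors whose entries on each cycle are congruent modulo the length of
  the cycle. Its Voronoi cell is the product of the centred prisms: by a separating hyperplane and
  summation by parts (Rado's theorem) the cell is the convex hull of the prism vertices, which lie
  on a sphere and hence are all extreme. Voronoi cells of a lattice tessellate, and the vertices of
  the suitably shifted tessellation are the invertible vectors.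

  For the group structure, a unit is turned into the permutation p -> (p + a_p) mod m of each
  cycle, together with the quotients (p + a_p) div m. Multiplication composes these permutations
  in reverse order, whence the inverse permutation and the negated quotients in the isomorphism.
*)

theory Submission
  imports Defs
begin

section \<open>Voronoi cells and tessellations\<close>

text \<open>On one cycle of length m the lattice is Z(1,...,1) + m Z^m. It contains every m e_p -
  (1,...,1), the projection of m e_p orthogonal to (1,...,1). So it is the orthogonal sum of
  Z(1,...,1) and a multiple of the dual root lattice A*_(m-1), whose Voronoi cell is classically a
  permutohedron. This is why the cell is a prism with axis (1,...,1) and height sqrt m. The tile
  needs two descriptions: inequalities, for which tiling is a question of nearest lattice points,
  and vertices, which are to be matched with the units. Their agreement is the main obstacle. It
  reduces to single cycles, because the lattice is an orthogonal sum over the cycles. Before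
  centring, the vertices of the two bases are the arrangements of 0,...,m-1 and of 1,...,m. Both are
  complete residue systems modulo m, which links them to the criterion for invertibility; m/2 is the
  middle of the joint range 0,...,m.\<close>

definition voronoi_cell :: "'a::real_inner set \<Rightarrow> 'a set" where
  "voronoi_cell L = {x. \<forall>t\<in>L. 2 * (x \<bullet> t) \<le> t \<bullet> t}"

lemma convex_voronoi_cell: "convex (voronoi_cell L)"
proof -
  have "voronoi_cell L = (\<Inter>t\<in>L. {x. t \<bullet> x \<le> (t \<bullet> t) / 2})"
    by (force simp: voronoi_cell_def inner_commute field_simps)
  then show ?thesis by (simp only: convex_INT convex_halfspace_le)
qed

text \<open>For t \<noteq> 0 the interior of the closed half-space of t is the open one. The
  strictness is what separates the interiors of neighbouring tiles.\<close>

lemma interior_voronoi_cell: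
  fixes t :: "'a::euclidean_space"
  assumes "x \<in> interior (voronoi_cell L)" "t \<in> L" "t \<noteq> 0"
  shows "2 * (x \<bullet> t) < t \<bullet> t"
proof -
  have "voronoi_cell L \<subseteq> {x. t \<bullet> x \<le> (t \<bullet> t) / 2}"
    using assms(2) by (auto simp: voronoi_cell_def inner_commute)
  then have "interior (voronoi_cell L) \<subseteq> interior {x. t \<bullet> x \<le> (t \<bullet> t) / 2}"
    by (rule interior_mono)
  then show ?thesis
    using assms interior_halfspace_le[of t "(t \<bullet> t) / 2"] by (auto simp: inner_commute[of x])
qed

text \<open>Each point lies in the tile of a nearest point of the shifted lattice; local finiteness
  guarantees that a nearest one exists. Closure under differences makes \<open>L\<close> a subgroup,
  so all cells are translates of the one at 0.\<close>

lemma tessellation_voronoi_cell: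
  fixes L :: "'a::euclidean_space set"
  assumes diff: "\<And>s t. s \<in> L \<Longrightarrow> t \<in> L \<Longrightarrow> s - t \<in> L"
    and "L \<noteq> {}"
    and fin: "\<And>x r. finite (L \<inter> cball x r)"
  shows "tessellation (translates (voronoi_cell L) ((+) c ` L))"
proof -
  have zero: "0 \<in> L" using \<open>L \<noteq> {}\<close> diff by (metis cancel_comm_monoid_add_class.diff_cancel ex_in_conv)
  then have add: "s + t \<in> L" if "s \<in> L" "t \<in> L" for s t
    using diff[of s "0 - t"] diff[of 0 t] that by simp
  have "x \<in> \<Union> (translates (voronoi_cell L) ((+) c ` L))" for x
  proof -
    \<comment> \<open>This ball reaches just to the lattice point 0. It holds finitely many lattice
      points, and those outside it are farther from x - c than 0 is.\<close>
    let ?M = "L \<inter> cball (x - c) (dist (x - c) 0)"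
    have "0 \<in> ?M" using zero by simp
    then obtain t where t: "t \<in> ?M" "\<And>s. s \<in> ?M \<Longrightarrow> dist (x - c) t \<le> dist (x - c) s"
      using fin[of "x - c" "dist (x - c) 0"] arg_min_if_finite[of ?M "dist (x - c)"]
      by (metis empty_iff not_le_imp_less)
    have min: "dist (x - c) t \<le> dist (x - c) s" if "s \<in> L" for s
    proof (cases "s \<in> ?M")
      case False
      then have "dist (x - c) 0 < dist (x - c) s" using that by auto
      then show ?thesis using t(2)[OF \<open>0 \<in> ?M\<close>] by simp
    qed (use t in blast)
    \<comment> \<open>The inequality defining the cell is |y| \<le> |y - s| squared and expanded,
      here for y = x - c - t.\<close>
    have "x - c - t \<in> voronoi_cell L"
      unfolding voronoi_cell_def
    proof safe
      fix s assume "s \<in> L"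
      then have "norm (x - c - t) \<le> norm (x - c - t - s)"
        using min[of "t + s"] add t(1) by (simp add: dist_norm algebra_simps)
      then have "(x - c - t) \<bullet> (x - c - t) \<le> (x - c - t - s) \<bullet> (x - c - t - s)"
        by (simp add: norm_le)
      also have "\<dots> = (x - c - t) \<bullet> (x - c - t) - 2 * ((x - c - t) \<bullet> s) + s \<bullet> s"
        unfolding inner_diff_left[of "x - c - t" s] inner_diff_right[of _ "x - c - t" s]
        by (simp add: inner_commute)
      finally show "2 * ((x - c - t) \<bullet> s) \<le> s \<bullet> s" by simp
    qed
    then have "x \<in> (+) (c + t) ` voronoi_cell L"
      by (rule rev_image_eqI) simp
    then show ?thesis using t(1) by (auto simp: translates_def)
  qed
  moreover have "interior ((+) (c + s) ` voronoi_cell L) \<inter> interior ((+) (c + t) ` voronoi_cell L) = {}"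
    if st: "s \<in> L" "t \<in> L" "s \<noteq> t" for s t
  proof (rule ccontr)
    assume "\<not> ?thesis"
    then obtain x y z where x: "x = c + s + y" "y \<in> interior (voronoi_cell L)"
      "x = c + t + z" "z \<in> interior (voronoi_cell L)"
      unfolding interior_translation by blast
    \<comment> \<open>With d = t - s = y - z, the sum of the two inequalities reads 2 d.d < 2
      d.d.\<close>
    have "2 * (y \<bullet> (t - s)) < (t - s) \<bullet> (t - s)" "2 * (z \<bullet> (s - t)) < (s - t) \<bullet> (s - t)"
      using interior_voronoi_cell x st diff by force+
    moreover have "y = z + (t - s)" using x by (simp add: algebra_simps)
    ultimately show False by (simp add: algebra_simps inner_commute)
  qed
  ultimately show ?thesis
    unfolding tessellation_def by (auto simp: translates_def pairwise_def)
qed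

text \<open>The tangent hyperplane of the sphere at w supports the whole ball and touches it only at
  w, so it also isolates w in the hull.\<close>

lemma extreme_point_of_convex_hull_sphere:
  fixes S :: "'a::euclidean_space set"
  assumes S: "S \<subseteq> sphere 0 r" and "w \<in> S"
  shows "w extreme_point_of (convex hull S)"
proof (rule extreme_point_of_Int_supporting_hyperplane_le)
  have nw: "norm w = r" using assms by auto
  have sub: "convex hull S \<subseteq> cball 0 r"
    by (rule hull_minimal) (use S in \<open>auto intro: convex_cball\<close>)
  show "w \<bullet> x \<le> r\<^sup>2" if "x \<in> convex hull S" for x
  proof -
    have "w \<bullet> x \<le> r * norm x" using norm_cauchy_schwarz[of w x] nw by simp
    also have "\<dots> \<le> r * r" using sub that nw norm_ge_zero[of w] by (intro mult_left_mono) auto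
    finally show ?thesis by (simp add: power2_eq_square)
  qed
  have "x = w" if "x \<in> convex hull S" "w \<bullet> x = r\<^sup>2" for x
  proof -
    have "norm x \<le> r" using sub that by auto
    then have "x \<bullet> x \<le> r\<^sup>2" by (simp add: power_mono flip: power2_norm_eq_inner)
    moreover have "w \<bullet> w = r\<^sup>2" using nw by (simp flip: power2_norm_eq_inner)
    ultimately have "(x - w) \<bullet> (x - w) \<le> 0"
      using that by (simp add: inner_diff_left inner_diff_right inner_commute)
    then show ?thesis by (metis eq_iff_diff_eq_0 inner_ge_zero inner_eq_zero_iff order_antisym)
  qed
  moreover have "w \<bullet> w = r\<^sup>2" using nw by (simp flip: power2_norm_eq_inner)
  ultimately show "convex hull S \<inter> {x. w \<bullet> x = r\<^sup>2} = {w}"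
    using \<open>w \<in> S\<close> by (auto intro: hull_inc)
qed

section \<open>Local finiteness of integer points\<close>

lemma finite_vec_components:
  assumes "\<And>i. finite (F i)"
  shows "finite {x :: 'a ^ 'n::finite. \<forall>i. x $ i \<in> F i}"
proof -
  have "{x :: 'a ^ 'n. \<forall>i. x $ i \<in> F i} \<subseteq> vec_lambda ` PiE UNIV F"
  proof
    fix x :: "'a ^ 'n" assume "x \<in> {x. \<forall>i. x $ i \<in> F i}"
    then have "x = vec_lambda (($) x)" "($) x \<in> PiE UNIV F" by auto
    then show "x \<in> vec_lambda ` PiE UNIV F" by blast
  qed
  then show ?thesis
    by (rule finite_subset) (intro finite_imageI finite_PiE finite assms)
qed

lemma finite_integer_points_cball:
  "finite ({t :: real ^ 'n::finite. \<forall>i. t $ i \<in> \<int>} \<inter> cball x r)"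
proof (rule finite_subset)
  show "{t :: real ^ 'n. \<forall>i. t $ i \<in> \<int>} \<inter> cball x r
      \<subseteq> {t. \<forall>i. t $ i \<in> {a \<in> \<int>. x $ i - r \<le> a \<and> a \<le> x $ i + r}}"
  proof
    fix t :: "real ^ 'n" assume t: "t \<in> {t. \<forall>i. t $ i \<in> \<int>} \<inter> cball x r"
    have "\<bar>x $ i - t $ i\<bar> \<le> r" for i
      using t component_le_norm_cart[of "x - t" i] by (simp add: dist_norm)
    then have "x $ i - r \<le> t $ i \<and> t $ i \<le> x $ i + r" for i
      by (smt (verit))
    with t show "t \<in> {t. \<forall>i. t $ i \<in> {a \<in> \<int>. x $ i - r \<le> a \<and> a \<le> x $ i + r}}" by simp
  qed
qed (intro finite_vec_components finite_int_segment)

section \<open>The prism over one cycle\<close>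

text \<open>The difference of the squares is m z (2 u + m z), and |2 u| \<le> m prevents the last
  factor from having the sign opposite to z. So u has least absolute value in its class modulo
  m.\<close>

lemma square_le_square_shift:
  fixes u :: real and z :: int
  assumes "\<bar>u\<bar> \<le> real m / 2"
  shows "u\<^sup>2 \<le> (u + real m * of_int z)\<^sup>2"
proof -
  have "0 \<le> of_int z * (2 * u + real m * of_int z)"
  proof (cases "z \<ge> 1")
    case True
    then have "real m * 1 \<le> real m * of_int z" by (intro mult_left_mono) auto
    with assms have "0 \<le> 2 * u + real m * of_int z" by linarith
    with True show ?thesis by simp
  next
    case False
    show ?thesis
    proof (cases "z = 0")
      case False
      with \<open>\<not> z \<ge> 1\<close> have z: "z \<le> -1" by simp
      then have "real_of_int z \<le> -1" by linarith
      then have "real m * of_int z \<le> real m * (-1)" by (intro mult_left_mono) auto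
      with assms have "2 * u + real m * of_int z \<le> 0" by linarith
      with z show ?thesis by (simp add: mult_nonpos_nonpos)
    qed simp
  qed
  then have "0 \<le> real m * (of_int z * (2 * u + real m * of_int z))" by simp
  then show ?thesis by (simp add: power2_eq_square algebra_simps)
qed

text \<open>
  On a cycle of length \<open>m\<close>, the vertices of the two bases (\<open>e = 0, 1\<close>) of the prism, centred at the
  origin; the positions on the cycle are numbered from \<open>0\<close>.
\<close>

definition prism_vertex :: "nat \<Rightarrow> (nat \<Rightarrow> nat) \<Rightarrow> nat \<Rightarrow> nat \<Rightarrow> real" where
  "prism_vertex m \<pi> e p = real (\<pi> p) + real e - real m / 2"

text \<open>The general element of Z(1,...,1) + m Z^m: \<open>s\<close> is the common residue of the
  entries and \<open>q\<close> is arbitrary.\<close>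

definition coset_vector :: "nat \<Rightarrow> int \<Rightarrow> (nat \<Rightarrow> int) \<Rightarrow> nat \<Rightarrow> real" where
  "coset_vector m s q p = of_int (s + int m * q p)"

text \<open>The Voronoi cell for one cycle. Vectors are functions on \<open>nat\<close> so that m
  can vary from cycle to cycle; the values from position m on are immaterial.\<close>

definition block_cell :: "nat \<Rightarrow> (nat \<Rightarrow> real) set" where
  "block_cell m = {x. \<forall>s q. 2 * (\<Sum>p<m. x p * coset_vector m s q p)
      \<le> (\<Sum>p<m. (coset_vector m s q p)\<^sup>2)}"

text \<open>Only a bijection of {..<m} is claimed, as the function need not fix the numbers from m
  on. It serves both the norm comparison for prism vertices and the proof that vertices of tiles are
  units.\<close>

lemma mod_shift_permutes:
  fixes s :: int
  assumes "\<pi> permutes {..<m}"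
  shows "bij_betw (\<lambda>p. nat ((int (\<pi> p) - s) mod int m)) {..<m} {..<m}"
proof -
  let ?f = "\<lambda>p. nat ((int (\<pi> p) - s) mod int m)"
  have "inj_on ?f {..<m}"
  proof (rule inj_onI)
    fix p p' assume *: "p \<in> {..<m}" "p' \<in> {..<m}" "?f p = ?f p'"
    then have m: "0 < int m" by auto
    from * m have "(int (\<pi> p) - s) mod int m = (int (\<pi> p') - s) mod int m"
      by (simp add: nat_eq_iff2)
    then have "int (\<pi> p) mod int m = int (\<pi> p') mod int m"
      by (metis diff_add_cancel mod_add_left_eq)
    moreover have "\<pi> p < m" "\<pi> p' < m"
      using * permutes_in_image[OF assms] by auto
    ultimately have "\<pi> p = \<pi> p'" by simp
    then show "p = p'" using permutes_inj[OF assms] by (simp add: inj_eq)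
  qed
  moreover have "?f ` {..<m} \<subseteq> {..<m}"
  proof safe
    fix p assume "p < m"
    then have "0 < int m" by simp
    then show "?f p < m" using pos_mod_bound[of "int m" "int (\<pi> p) - s"] pos_mod_sign[of "int m" "int (\<pi> p) - s"] by linarith
  qed
  ultimately show ?thesis
    by (simp add: bij_betw_def endo_inj_surj)
qed


text \<open>
  The entries of a prism vertex are pairwise incongruent modulo \<open>m\<close>, and each has minimal absolute
  value in its class. Subtracting a coset vector permutes the classes, so it cannot decrease the
  norm.
\<close>

lemma prism_vertex_in_block_cell:
  assumes \<pi>: "\<pi> permutes {..<m}" and e: "e \<le> 1"
  shows "prism_vertex m \<pi> e \<in> block_cell m"
proof -
  have "2 * (\<Sum>p<m. prism_vertex m \<pi> e p * coset_vector m s q p) \<le> (\<Sum>p<m. (coset_vector m s q p)\<^sup>2)"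
    for s q
  proof -
    let ?w = "prism_vertex m \<pi> e" and ?t = "coset_vector m s q"
    let ?g = "\<lambda>r. (real r + real e - real m / 2)\<^sup>2"
    \<comment> \<open>Entry p of w - t is congruent to \<rho> p + e - m/2 modulo m, so \<rho> names
      the prism value that it is compared with.\<close>
    define \<rho> where "\<rho> p = nat ((int (\<pi> p) - s) mod int m)" for p
    have "(\<Sum>p<m. (?w p)\<^sup>2) = (\<Sum>p<m. ?g p)"
      unfolding prism_vertex_def
      by (rule sum.reindex_bij_betw[where g = ?g], rule permutes_imp_bij[OF \<pi>])
    also have "\<dots> = (\<Sum>p<m. ?g (\<rho> p))"
      unfolding \<rho>_def by (rule sum.reindex_bij_betw[symmetric, where g = ?g], rule mod_shift_permutes[OF \<pi>])
    also have "\<dots> \<le> (\<Sum>p<m. (?w p - ?t p)\<^sup>2)"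
    proof (rule sum_mono)
      fix p assume "p \<in> {..<m}"
      then have m: "0 < int m" by simp
      define d where "d = (int (\<pi> p) - s) div int m"
      have \<rho>: "int (\<rho> p) = (int (\<pi> p) - s) mod int m" using m by (simp add: \<rho>_def)
      then have "int (\<rho> p) < int m" using m by simp
      \<comment> \<open>Since \<rho> p + e lies between 0 and m, centring at m/2 gives exactly the
        bound needed for minimality.\<close>
      then have "\<bar>real (\<rho> p) + real e - real m / 2\<bar> \<le> real m / 2"
        using e by linarith
      then have "?g (\<rho> p) \<le> (real (\<rho> p) + real e - real m / 2 + real m * of_int (d - q p))\<^sup>2"
        by (rule square_le_square_shift)
      moreover have "int (\<pi> p) - s = int (\<rho> p) + int m * d"
        using \<rho> by (simp add: d_def)
      then have "of_int (int (\<pi> p) - s) = (of_int (int (\<rho> p) + int m * d) :: real)" by simp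
      then have "?w p - ?t p = real (\<rho> p) + real e - real m / 2 + real m * of_int (d - q p)"
        by (simp add: prism_vertex_def coset_vector_def algebra_simps)
      ultimately show "?g (\<rho> p) \<le> (?w p - ?t p)\<^sup>2" by simp
    qed
    also have "\<dots> = (\<Sum>p<m. (?w p)\<^sup>2) + (\<Sum>p<m. (?t p)\<^sup>2) - 2 * (\<Sum>p<m. ?w p * ?t p)"
      by (simp add: power2_diff sum.distrib sum_subtractf sum_distrib_left mult.assoc)
    finally show ?thesis by simp
  qed
  then show ?thesis by (simp add: block_cell_def)
qed

text \<open>Passing from e = 0 to e = 1 replaces the set of values -m/2, ..., m/2 - 1 by -m/2 + 1,
  ..., m/2. Only -m/2 is exchanged, for m/2, so the vertices of both bases lie on one
  sphere.\<close>

lemma sum_prism_vertex_square: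
  assumes "\<pi> permutes {..<m}" "e \<le> 1"
  shows "(\<Sum>p<m. (prism_vertex m \<pi> e p)\<^sup>2) = (\<Sum>p<m. (real p - real m / 2)\<^sup>2)"
proof -
  let ?g = "\<lambda>r. (real r + real e - real m / 2)\<^sup>2"
  have "(\<Sum>p<m. (prism_vertex m \<pi> e p)\<^sup>2) = (\<Sum>p<m. ?g p)"
    unfolding prism_vertex_def
    by (rule sum.reindex_bij_betw[where g = ?g], rule permutes_imp_bij[OF assms(1)])
  moreover have "(\<Sum>p<m. (real (Suc p) - real m / 2)\<^sup>2) = (\<Sum>p<m. (real p - real m / 2)\<^sup>2)"
    using sum.lessThan_Suc_shift[of "\<lambda>p. (real p - real m / 2)\<^sup>2" m]
    by (simp add: power2_eq_square algebra_simps)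
  moreover have "e = 0 \<or> e = 1" using assms(2) by auto
  ultimately show ?thesis by (auto simp: algebra_simps)
qed

section \<open>Maximising a linear functional over the prism\<close>

lemma ex_sorting_permutation:
  fixes a :: "nat \<Rightarrow> 'a::linorder"
  obtains g where "g permutes {..<m}" "\<And>i. Suc i < m \<Longrightarrow> a (g i) \<le> a (g (Suc i))"
proof -
  define ys where "ys = sort_key a [0..<m]"
  have ys: "length ys = m" "distinct ys" "set ys = {..<m}" "sorted (map a ys)"
    by (auto simp: ys_def)
  define g where "g i = (if i < m then ys ! i else i)" for i
  have "bij_betw ((!) ys) {..<m} {..<m}"
    by (rule bij_betw_nth) (simp_all add: ys)
  then have "bij_betw g {..<m} {..<m}"
    by (rule bij_betw_cong[THEN iffD1, rotated]) (simp add: g_def)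
  then have "g permutes {..<m}"
    by (rule bij_imp_permutes) (simp add: g_def)
  moreover have "a (g i) \<le> a (g (Suc i))" if "Suc i < m" for i
    using sorted_nth_mono[OF ys(4), of i "Suc i"] that ys(1) by (simp add: g_def)
  ultimately show ?thesis by (rule that)
qed

text \<open>With D_i the sum of d_0, ..., d_i, the left side is a_k D_k minus the sum of (a_(i+1) -
  a_i) D_i over i < k, and each of these products is nonnegative. The sign of the total D_k is left
  open.\<close>

lemma abel_sum_le:
  fixes a d :: "nat \<Rightarrow> real"
  assumes mono: "\<And>i. Suc i \<le> k \<Longrightarrow> a i \<le> a (Suc i)"
    and pos: "\<And>i. i \<le> k \<Longrightarrow> 0 \<le> sum d {..<i}"
  shows "(\<Sum>i\<le>k. a i * d i) \<le> a k * sum d {..k}"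
  using assms
proof (induction k)
  case (Suc k)
  have "0 \<le> sum d {..k}" using Suc.prems(2)[of "Suc k"] by (simp add: lessThan_Suc_atMost)
  then have "a k * sum d {..k} \<le> a (Suc k) * sum d {..k}"
    using Suc.prems(1)[of k] by (intro mult_right_mono) auto
  with Suc show ?case by (fastforce simp: algebra_simps)
qed simp

text \<open>
  The facet inequalities of the permutohedron, obtained by testing membership in the cell against
  the coset vector that equals \<open>card S - m\<close> on \<open>S\<close> and \<open>card S\<close> elsewhere.
\<close>

lemma block_cell_prefix:
  assumes x: "x \<in> block_cell m" and S: "S \<subseteq> {..<m}"
  shows "real m * sum x S \<ge> real (card S) * sum x {..<m} - real m * real (card S) * (real m - real (card S)) / 2"
proof -
  let ?c = "card S"
  define q where "q p = (if p \<in> S then -1 else 0 :: int)" for p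
  have fin: "finite S" using S finite_subset by blast
  have split: "{..<m} = S \<union> ({..<m} - S)" using S by auto
  have card: "real (card ({..<m} - S)) = real m - real ?c"
    using S fin card_mono[OF _ S] by (simp add: card_Diff_subset of_nat_diff)
  have "2 * (\<Sum>p<m. x p * coset_vector m (int ?c) q p) \<le> (\<Sum>p<m. (coset_vector m (int ?c) q p)\<^sup>2)"
    using x by (simp add: block_cell_def)
  also have "\<dots> = (\<Sum>p\<in>S. (coset_vector m (int ?c) q p)\<^sup>2) + (\<Sum>p\<in>{..<m}-S. (coset_vector m (int ?c) q p)\<^sup>2)"
    using fin by (subst split, subst sum.union_disjoint) auto
  also have "\<dots> = (\<Sum>p\<in>S. (real ?c - real m)\<^sup>2) + (\<Sum>p\<in>{..<m}-S. (real ?c)\<^sup>2)"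
    by (intro arg_cong2[where f = "(+)"] sum.cong) (auto simp: coset_vector_def q_def)
  also have "\<dots> = real ?c * (real m - real ?c) * real m"
    by (simp add: card power2_eq_square algebra_simps)
  finally have 1: "2 * (\<Sum>p<m. x p * coset_vector m (int ?c) q p) \<le> real ?c * (real m - real ?c) * real m" .
  have "(\<Sum>p<m. x p * coset_vector m (int ?c) q p) = (\<Sum>p<m. real ?c * x p - real m * (if p \<in> S then x p else 0))"
    by (intro sum.cong) (auto simp: coset_vector_def q_def algebra_simps)
  also have "\<dots> = real ?c * sum x {..<m} - real m * (\<Sum>p<m. if p \<in> S then x p else 0)"
    by (simp add: sum_subtractf sum_distrib_left)
  also have "(\<Sum>p<m. if p \<in> S then x p else 0) = sum x S"
    using S by (simp add: sum.If_cases Int_absorb1 Int_commute inf.absorb1)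
  finally show ?thesis using 1 by (simp add: field_simps)
qed

text \<open>The test vectors (1,...,1) and its negative give the two facets orthogonal to the axis.
  With \<open>block_cell_prefix\<close> they are all the inequalities that the comparison with the
  vertices uses.\<close>

lemma block_cell_mean:
  assumes "x \<in> block_cell m" "0 < m"
  shows "\<bar>sum x {..<m}\<bar> \<le> real m / 2"
proof -
  have "2 * (\<Sum>p<m. x p * coset_vector m s (\<lambda>_. 0) p) \<le> (\<Sum>p<m. (coset_vector m s (\<lambda>_. 0) p)\<^sup>2)" for s
    using assms by (simp add: block_cell_def)
  from this[of 1] this[of "-1"] show ?thesis
    by (simp add: coset_vector_def sum_negf)
qed

text \<open>
  Sort the coefficients \<open>a\<close> and let \<open>\<pi>\<close> rank the positions accordingly. The partial sums of the
  difference of \<open>x\<close> and the vertex along this order are nonnegative by \<open>block_cell_prefix\<close>, so summation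
  by parts gives the claim.
\<close>

lemma block_cell_le_prism_vertex:
  fixes a :: "nat \<Rightarrow> real"
  assumes x: "x \<in> block_cell m" and m: "0 < m"
  obtains \<pi> e where "\<pi> permutes {..<m}" "e \<le> 1"
    "(\<Sum>p<m. a p * x p) \<le> (\<Sum>p<m. a p * prism_vertex m \<pi> e p)"
proof -
  obtain g where g: "g permutes {..<m}" and mono: "\<And>i. Suc i < m \<Longrightarrow> a (g i) \<le> a (g (Suc i))"
    using ex_sorting_permutation by metis
  \<comment> \<open>\<xi> is the mean of x, its coordinate along the axis. In d it is removed,
    together with the centred value i - (m - 1)/2 that the permutohedron vertex has at position g
    i.\<close>
  define \<xi> where "\<xi> = sum x {..<m} / real m"
  define d where "d i = x (g i) - (real i - (real m - 1) / 2) - \<xi>" for i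
  have gauss: "(\<Sum>i<k. real i - (real m - 1) / 2) = - real k * (real m - real k) / 2" for k
    by (induction k) (auto simp: field_simps)
  have sum_d: "sum d {..<k} = sum x (g ` {..<k}) + real k * (real m - real k) / 2 - real k * \<xi>" for k
  proof -
    have "sum d {..<k} = (\<Sum>i<k. x (g i)) - (\<Sum>i<k. real i - (real m - 1) / 2) - real k * \<xi>"
      by (simp add: d_def sum_subtractf)
    moreover have "sum x (g ` {..<k}) = (\<Sum>i<k. x (g i))"
      using permutes_inj[OF g] by (simp add: sum.reindex[OF inj_on_subset[of g UNIV]])
    ultimately show ?thesis using gauss[of k] by (simp add: field_simps)
  qed
  have pos: "0 \<le> sum d {..<k}" if "k \<le> m" for k
  proof -
    have "g ` {..<k} \<subseteq> {..<m}" using that image_mono[of "{..<k}" "{..<m}" g] permutes_image[OF g] by simp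
    moreover have "card (g ` {..<k}) = k"
      using permutes_inj[OF g] by (simp add: card_image inj_on_subset)
    ultimately have "real m * sum x (g ` {..<k}) \<ge> real k * sum x {..<m} - real m * real k * (real m - real k) / 2"
      using block_cell_prefix[OF x, of "g ` {..<k}"] by simp
    moreover have "sum x {..<m} = real m * \<xi>" using m by (simp add: \<xi>_def)
    ultimately have "0 \<le> real m * sum d {..<k}" unfolding sum_d by (simp add: algebra_simps)
    then show ?thesis using m by (simp add: zero_le_mult_iff)
  qed
  have total: "sum d {..<m} = 0"
    using m by (simp add: sum_d permutes_image[OF g] \<xi>_def)
  obtain k where k: "m = Suc k" using m gr0_implies_Suc by blast
  have "(\<Sum>i\<le>k. a (g i) * d i) \<le> a (g k) * sum d {..k}"
    using mono pos k by (intro abel_sum_le[where a = "\<lambda>i. a (g i)"]) auto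
  then have ad: "(\<Sum>i<m. a (g i) * d i) \<le> 0"
    using total by (simp add: k lessThan_Suc_atMost)
  \<comment> \<open>Along the axis the functional has slope \<open>sum a {..<m}\<close>, whose sign
    decides which base is better.\<close>
  define e :: nat where "e = (if 0 \<le> sum a {..<m} then 1 else 0)"
  have "\<bar>\<xi>\<bar> \<le> 1 / 2"
    using block_cell_mean[OF x m] m by (simp add: \<xi>_def field_simps)
  then have \<xi>: "\<xi> * sum a {..<m} \<le> (real e - 1 / 2) * sum a {..<m}"
    using mult_right_mono[of \<xi> "1 / 2" "sum a {..<m}"] mult_right_mono_neg[of "- 1 / 2" \<xi> "sum a {..<m}"]
    by (auto simp: e_def)
  have reindex: "(\<Sum>i<m. h (g i)) = (\<Sum>p<m. h p)" for h :: "nat \<Rightarrow> real"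
    by (rule sum.reindex_bij_betw, rule permutes_imp_bij[OF g])
  \<comment> \<open>The inverse of g is the rank: position g i receives value i, so larger
    coefficients meet larger values.\<close>
  let ?w = "prism_vertex m (inv_into UNIV g) e"
  have inv: "inv_into UNIV g (g i) = i" for i using permutes_inverses(2)[OF g] by simp
  have "(\<Sum>p<m. a p * ?w p) - (\<Sum>p<m. a p * x p) = (\<Sum>i<m. a (g i) * ?w (g i) - a (g i) * x (g i))"
    using reindex[of "\<lambda>p. a p * ?w p"] reindex[of "\<lambda>p. a p * x p"] by (simp add: sum_subtractf)
  \<comment> \<open>Here w (g i) = (i - (m - 1)/2) + (e - 1/2). The gap splits into an axial part,
    controlled by the choice of e, and the part treated by summation by parts.\<close>
  also have "\<dots> = (\<Sum>i<m. (real e - 1 / 2 - \<xi>) * a (g i) - a (g i) * d i)"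
    by (intro sum.cong) (auto simp: prism_vertex_def inv d_def field_simps)
  also have "\<dots> = (real e - 1 / 2 - \<xi>) * sum a {..<m} - (\<Sum>i<m. a (g i) * d i)"
    using reindex[of a] by (simp add: sum_subtractf flip: sum_distrib_left)
  finally have "(\<Sum>p<m. a p * x p) \<le> (\<Sum>p<m. a p * ?w p)"
    using ad \<xi> by (simp add: left_diff_distrib)
  moreover have "inv_into UNIV g permutes {..<m}" using g by (rule permutes_inv)
  moreover have "e \<le> 1" by (simp add: e_def)
  ultimately show ?thesis using that by blast
qed

section \<open>The tile as a product of prisms\<close>

text \<open>\<open>label j p\<close> is the element at position p of cycle j, counted from 0, and
  \<tau> advances the position modulo the length. This is all that the geometry and the algebra need
  to know about the cycle decomposition.\<close>

locale cycle_labelling =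
  fixes \<tau> :: "'n::finite \<Rightarrow> 'n" and ms :: "nat list" and label :: "nat \<Rightarrow> nat \<Rightarrow> 'n"
  assumes permutes: "\<tau> permutes UNIV"
    and bij_label: "bij_betw (\<lambda>(j, p). label j p) (SIGMA j:{..<length ms}. {..<ms ! j}) UNIV"
    and length_pos: "j < length ms \<Longrightarrow> 0 < ms ! j"
    and perm_label: "j < length ms \<Longrightarrow> p < ms ! j \<Longrightarrow> \<tau> (label j p) = label j (Suc p mod ms ! j)"
begin

lemma label_cases:
  obtains j p where "i = label j p" "j < length ms" "p < ms ! j"
proof -
  have "i \<in> (\<lambda>(j, p). label j p) ` (SIGMA j:{..<length ms}. {..<ms ! j})"
    using bij_label by (simp add: bij_betw_def)
  then show ?thesis using that by (force simp: image_iff)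
qed

lemma label_eq_iff:
  assumes "j < length ms" "p < ms ! j" "j' < length ms" "p' < ms ! j'"
  shows "label j p = label j' p' \<longleftrightarrow> j = j' \<and> p = p'"
  using bij_betw_imp_inj_on[OF bij_label] assms by (force dest: inj_onD[where x = "(j, p)" and y = "(j', p')"])

lemma sum_label:
  fixes f :: "'n \<Rightarrow> 'b::comm_monoid_add"
  shows "sum f UNIV = (\<Sum>j<length ms. \<Sum>p<ms ! j. f (label j p))"
  using sum.reindex_bij_betw[OF bij_label, of f] by (simp add: sum.Sigma case_prod_unfold)

definition from_blocks :: "(nat \<Rightarrow> nat \<Rightarrow> 'b) \<Rightarrow> 'b ^ 'n" where
  "from_blocks F = (\<chi> i. case inv_into (SIGMA j:{..<length ms}. {..<ms ! j}) (\<lambda>(j, p). label j p) i of (j, p) \<Rightarrow> F j p)"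

lemma from_blocks_label [simp]:
  assumes "j < length ms" "p < ms ! j"
  shows "from_blocks F $ label j p = F j p"
  using inv_into_f_f[OF bij_betw_imp_inj_on[OF bij_label], of "(j, p)"] assms
  by (simp add: from_blocks_def)

lemma inner_label:
  fixes x y :: "real ^ 'n"
  shows "x \<bullet> y = (\<Sum>j<length ms. \<Sum>p<ms ! j. x $ label j p * y $ label j p)"
  by (simp add: inner_vec_def sum_label)

definition tile_lattice :: "(real ^ 'n) set" where
  "tile_lattice = {t. \<exists>s q. \<forall>j<length ms. \<forall>p<ms ! j. t $ label j p = coset_vector (ms ! j) (s j) (q j) p}"

definition tile_vertices :: "(real ^ 'n) set" where
  "tile_vertices = {w. \<exists>\<pi> e. \<forall>j<length ms. \<pi> j permutes {..<ms ! j} \<and> e j \<le> 1 \<and>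
     (\<forall>p<ms ! j. w $ label j p = prism_vertex (ms ! j) (\<pi> j) (e j) p)}"

lemma tile_lattice_diff:
  assumes "t \<in> tile_lattice" "u \<in> tile_lattice"
  shows "t - u \<in> tile_lattice"
proof -
  obtain s q s' q' where "\<forall>j<length ms. \<forall>p<ms ! j. t $ label j p = coset_vector (ms ! j) (s j) (q j) p"
    "\<forall>j<length ms. \<forall>p<ms ! j. u $ label j p = coset_vector (ms ! j) (s' j) (q' j) p"
    using assms unfolding tile_lattice_def by blast
  then have "\<forall>j<length ms. \<forall>p<ms ! j.
      (t - u) $ label j p = coset_vector (ms ! j) (s j - s' j) (\<lambda>p. q j p - q' j p) p"
    by (simp add: coset_vector_def algebra_simps)
  then show ?thesis
    unfolding tile_lattice_def by (intro CollectI exI[of _ "\<lambda>j. s j - s' j"] exI[of _ "\<lambda>j p. q j p - q' j p"])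
qed

lemma zero_in_tile_lattice: "0 \<in> tile_lattice"
  unfolding tile_lattice_def
  by (intro CollectI exI[of _ "\<lambda>_. 0"] exI[of _ "\<lambda>_ _. 0"]) (simp add: coset_vector_def)

lemma finite_tile_lattice_cball: "finite (tile_lattice \<inter> cball x r)"
proof (rule finite_subset)
  have "t $ i \<in> \<int>" if t: "t \<in> tile_lattice" for t i
  proof -
    obtain j p where jp: "i = label j p" "j < length ms" "p < ms ! j" by (rule label_cases)
    then obtain s q where "t $ i = coset_vector (ms ! j) s q p"
      using t unfolding tile_lattice_def by blast
    then show ?thesis by (simp add: coset_vector_def)
  qed
  then show "tile_lattice \<inter> cball x r \<subseteq> {t. \<forall>i. t $ i \<in> \<int>} \<inter> cball x r" by blast
qed (rule finite_integer_points_cball)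

text \<open>The lattice is an orthogonal sum: extending a coset vector by zero stays in it, which
  isolates the inequalities of one cycle, and conversely these inequalities add up over the
  cycles.\<close>

lemma voronoi_cell_tile_lattice_iff:
  "x \<in> voronoi_cell tile_lattice \<longleftrightarrow> (\<forall>j<length ms. (\<lambda>p. x $ label j p) \<in> block_cell (ms ! j))"
proof safe
  fix j assume x: "x \<in> voronoi_cell tile_lattice" and j: "j < length ms"
  show "(\<lambda>p. x $ label j p) \<in> block_cell (ms ! j)"
    unfolding block_cell_def
  proof safe
    fix s q
    define t where "t = from_blocks (\<lambda>i p. if i = j then coset_vector (ms ! j) s q p else 0)"
    have "t \<in> tile_lattice"
      unfolding tile_lattice_def t_def
      by (intro CollectI exI[of _ "\<lambda>i. if i = j then s else 0"] exI[of _ "\<lambda>i. if i = j then q else (\<lambda>_. 0)"])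
        (auto simp: coset_vector_def)
    then have "2 * (x \<bullet> t) \<le> t \<bullet> t" using x by (simp add: voronoi_cell_def)
    moreover have "y \<bullet> t = (\<Sum>p<ms ! j. y $ label j p * coset_vector (ms ! j) s q p)" for y
    proof -
      have "y \<bullet> t = (\<Sum>i<length ms. if i = j then \<Sum>p<ms ! j. y $ label j p * coset_vector (ms ! j) s q p else 0)"
        unfolding inner_label by (intro sum.cong) (auto simp: t_def intro!: sum.cong)
      then show ?thesis using j by simp
    qed
    then have "x \<bullet> t = (\<Sum>p<ms ! j. x $ label j p * coset_vector (ms ! j) s q p)"
      "t \<bullet> t = (\<Sum>p<ms ! j. (coset_vector (ms ! j) s q p)\<^sup>2)"
      using j by (auto simp: power2_eq_square t_def)
    ultimately show "2 * (\<Sum>p<ms ! j. x $ label j p * coset_vector (ms ! j) s q p)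
        \<le> (\<Sum>p<ms ! j. (coset_vector (ms ! j) s q p)\<^sup>2)" by simp
  qed
next
  assume x: "\<forall>j<length ms. (\<lambda>p. x $ label j p) \<in> block_cell (ms ! j)"
  show "x \<in> voronoi_cell tile_lattice"
    unfolding voronoi_cell_def
  proof safe
    fix t assume "t \<in> tile_lattice"
    then obtain s q where t: "\<And>j p. j < length ms \<Longrightarrow> p < ms ! j \<Longrightarrow> t $ label j p = coset_vector (ms ! j) (s j) (q j) p"
      unfolding tile_lattice_def by blast
    have "2 * (x \<bullet> t) = (\<Sum>j<length ms. 2 * (\<Sum>p<ms ! j. x $ label j p * coset_vector (ms ! j) (s j) (q j) p))"
      by (simp add: inner_label t sum_distrib_left)
    also have "\<dots> \<le> (\<Sum>j<length ms. \<Sum>p<ms ! j. (coset_vector (ms ! j) (s j) (q j) p)\<^sup>2)"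
      using x by (intro sum_mono) (simp add: block_cell_def)
    also have "\<dots> = t \<bullet> t" by (simp add: inner_label t power2_eq_square)
    finally show "2 * (x \<bullet> t) \<le> t \<bullet> t" .
  qed
qed

lemma tile_vertices_in_cell: "tile_vertices \<subseteq> voronoi_cell tile_lattice"
proof
  fix w assume "w \<in> tile_vertices"
  then obtain \<pi> e where w: "\<And>j. j < length ms \<Longrightarrow> \<pi> j permutes {..<ms ! j} \<and> e j \<le> 1 \<and>
     (\<forall>p<ms ! j. w $ label j p = prism_vertex (ms ! j) (\<pi> j) (e j) p)"
    unfolding tile_vertices_def by blast
  show "w \<in> voronoi_cell tile_lattice"
    unfolding voronoi_cell_tile_lattice_iff
  proof (intro allI impI)
    fix j assume j: "j < length ms"
    then have "prism_vertex (ms ! j) (\<pi> j) (e j) \<in> block_cell (ms ! j)"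
      using w prism_vertex_in_block_cell by blast
    then show "(\<lambda>p. w $ label j p) \<in> block_cell (ms ! j)"
      using w[OF j] by (simp add: block_cell_def)
  qed
qed

lemma finite_tile_vertices: "finite tile_vertices"
proof (rule finite_subset)
  define F where "F = (\<Union>j<length ms. \<Union>a<ms ! j. \<Union>e\<le>1::nat. {real a + real e - real (ms ! j) / 2})"
  show "tile_vertices \<subseteq> {w. \<forall>i. w $ i \<in> F}"
  proof safe
    fix w i assume "w \<in> tile_vertices"
    then obtain \<pi> e where w: "\<And>j. j < length ms \<Longrightarrow> \<pi> j permutes {..<ms ! j} \<and> e j \<le> 1 \<and>
       (\<forall>p<ms ! j. w $ label j p = prism_vertex (ms ! j) (\<pi> j) (e j) p)"
      unfolding tile_vertices_def by blast
    obtain j p where jp: "i = label j p" "j < length ms" "p < ms ! j" by (rule label_cases)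
    have "\<pi> j p < ms ! j" using w[OF jp(2)] jp(3) permutes_in_image[of "\<pi> j" "{..<ms ! j}" p] by simp
    moreover have "w $ i = real (\<pi> j p) + real (e j) - real (ms ! j) / 2" "e j \<le> 1"
      using w[OF jp(2)] jp by (auto simp: prism_vertex_def)
    ultimately show "w $ i \<in> F"
      using jp(2) unfolding F_def by blast
  qed
  show "finite {w :: real ^ 'n. \<forall>i. w $ i \<in> F}"
    by (rule finite_vec_components) (auto simp: F_def)
qed

text \<open>A linear functional is a sum over the cycles, so a good vertex can be chosen in each
  prism independently.\<close>

lemma cell_le_tile_vertex:
  assumes x: "x \<in> voronoi_cell tile_lattice"
  obtains w where "w \<in> tile_vertices" "a \<bullet> x \<le> a \<bullet> w"
proof -
  define Q where "Q j \<pi> e \<longleftrightarrow> \<pi> permutes {..<ms ! j} \<and> e \<le> 1 \<and>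
      (\<Sum>p<ms ! j. a $ label j p * x $ label j p) \<le> (\<Sum>p<ms ! j. a $ label j p * prism_vertex (ms ! j) \<pi> e p)"
    for j \<pi> e
  have "\<forall>j\<in>{..<length ms}. \<exists>\<pi> e. Q j \<pi> e"
  proof
    fix j assume "j \<in> {..<length ms}"
    then have j: "j < length ms" by simp
    then have "(\<lambda>p. x $ label j p) \<in> block_cell (ms ! j)" using x by (simp add: voronoi_cell_tile_lattice_iff)
    then obtain \<pi> e where "\<pi> permutes {..<ms ! j}" "e \<le> 1"
      "(\<Sum>p<ms ! j. a $ label j p * x $ label j p) \<le> (\<Sum>p<ms ! j. a $ label j p * prism_vertex (ms ! j) \<pi> e p)"
      using block_cell_le_prism_vertex[OF _ length_pos[OF j], of "\<lambda>p. x $ label j p" "\<lambda>p. a $ label j p"]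
      by blast
    then show "\<exists>\<pi> e. Q j \<pi> e" unfolding Q_def by blast
  qed
  from bchoice[OF this] obtain \<pi> where "\<forall>j\<in>{..<length ms}. \<exists>e. Q j (\<pi> j) e" ..
  from bchoice[OF this] obtain e where "\<forall>j\<in>{..<length ms}. Q j (\<pi> j) (e j)" ..
  then have \<pi>: "\<And>j. j < length ms \<Longrightarrow> \<pi> j permutes {..<ms ! j} \<and> e j \<le> 1 \<and>
      (\<Sum>p<ms ! j. a $ label j p * x $ label j p) \<le> (\<Sum>p<ms ! j. a $ label j p * prism_vertex (ms ! j) (\<pi> j) (e j) p)"
    unfolding Q_def by simp
  define w where "w = from_blocks (\<lambda>j. prism_vertex (ms ! j) (\<pi> j) (e j))"
  have "w \<in> tile_vertices"
    unfolding tile_vertices_def using \<pi> by (intro CollectI exI[of _ \<pi>] exI[of _ e]) (simp add: w_def)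
  moreover have "a \<bullet> x \<le> a \<bullet> w"
    unfolding inner_label by (rule sum_mono) (use \<pi> in \<open>simp add: w_def\<close>)
  ultimately show ?thesis by (rule that)
qed

lemma voronoi_cell_tile_lattice_eq: "voronoi_cell tile_lattice = convex hull tile_vertices"
proof
  show "convex hull tile_vertices \<subseteq> voronoi_cell tile_lattice"
    using tile_vertices_in_cell convex_voronoi_cell by (rule hull_minimal)
  show "voronoi_cell tile_lattice \<subseteq> convex hull tile_vertices"
  proof (rule ccontr)
    assume "\<not> ?thesis"
    then obtain x where x: "x \<in> voronoi_cell tile_lattice" "x \<notin> convex hull tile_vertices" by blast
    have "closed (convex hull tile_vertices)"
      using finite_tile_vertices by (simp add: compact_imp_closed finite_imp_compact_convex_hull)
    then obtain a b where ab: "a \<bullet> x < b" "\<forall>y\<in>convex hull tile_vertices. b < a \<bullet> y"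
      using separating_hyperplane_closed_point[OF convex_convex_hull _ x(2)] by blast
    \<comment> \<open>The separation puts x on the lower side of the hyperplane, hence the
      functional -a.\<close>
    obtain w where "w \<in> tile_vertices" "- a \<bullet> x \<le> - a \<bullet> w"
      using cell_le_tile_vertex[OF x(1)] by blast
    then show False using ab hull_inc[of w tile_vertices convex] by fastforce
  qed
qed

lemma extreme_point_of_cell_iff: "w extreme_point_of voronoi_cell tile_lattice \<longleftrightarrow> w \<in> tile_vertices"
proof
  define r where "r = sqrt (\<Sum>j<length ms. \<Sum>p<ms ! j. (real p - real (ms ! j) / 2)\<^sup>2)"
  have "tile_vertices \<subseteq> sphere 0 r"
  proof
    fix w assume "w \<in> tile_vertices"
    then obtain \<pi> e where w: "\<And>j. j < length ms \<Longrightarrow> \<pi> j permutes {..<ms ! j} \<and> e j \<le> 1 \<and>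
       (\<forall>p<ms ! j. w $ label j p = prism_vertex (ms ! j) (\<pi> j) (e j) p)"
      unfolding tile_vertices_def by blast
    have "w \<bullet> w = (\<Sum>j<length ms. \<Sum>p<ms ! j. (prism_vertex (ms ! j) (\<pi> j) (e j) p)\<^sup>2)"
      using w by (simp add: inner_label power2_eq_square)
    also have "\<dots> = (\<Sum>j<length ms. \<Sum>p<ms ! j. (real p - real (ms ! j) / 2)\<^sup>2)"
      using w by (intro sum.cong sum_prism_vertex_square) auto
    finally show "w \<in> sphere 0 r" by (simp add: r_def norm_eq_sqrt_inner)
  qed
  then show "w \<in> tile_vertices \<Longrightarrow> w extreme_point_of voronoi_cell tile_lattice"
    unfolding voronoi_cell_tile_lattice_eq by (rule extreme_point_of_convex_hull_sphere)
qed (simp add: voronoi_cell_tile_lattice_eq extreme_point_of_convex_hull)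

end

section \<open>Congruence with the product of prisms\<close>

lemma lookup_scaleR [simp]:
  "Poly_Mapping.lookup (r *\<^sub>R x) i = r *\<^sub>R Poly_Mapping.lookup x i"
  for x :: "'a \<Rightarrow>\<^sub>0 'b::real_vector"
proof -
  have "finite {i. r *\<^sub>R Poly_Mapping.lookup x i \<noteq> 0}"
    by (rule finite_subset[OF _ finite_lookup[of x]]) auto
  then show ?thesis by (simp add: scaleR_poly_mapping_def)
qed

lemma permutohedron_induct [consumes 1, case_names vertex convex]:
  assumes "x \<in> permutohedron d"
    and "\<And>x p. p permutes {1..d + 1} \<Longrightarrow> 
       (\<And>i. Poly_Mapping.lookup x i = (if i \<in> {1..d + 1} then real (p i) else 0)) \<Longrightarrow> Q x"
    and "\<And>x y u v. Q x \<Longrightarrow> Q y \<Longrightarrow> 0 \<le> u \<Longrightarrow> 0 \<le> v \<Longrightarrow> u + v = 1 \<Longrightarrow> Q (u *\<^sub>R x + v *\<^sub>R y)"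
  shows "Q x"
proof -
  have "permutohedron d \<subseteq> {x. Q x}"
    unfolding permutohedron_def
    by (rule hull_minimal) (use assms(2,3) in \<open>auto simp: convex_def\<close>)
  with assms(1) show ?thesis by blast
qed

lemma convex_permutohedron: "convex (permutohedron d)"
  unfolding permutohedron_def by (rule convex_convex_hull)

lemma permutohedron_support:
  assumes "x \<in> permutohedron d" "i \<notin> {1..d + 1}"
  shows "Poly_Mapping.lookup x i = 0"
  using assms(1) by (induction rule: permutohedron_induct) (use assms(2) in \<open>auto simp: lookup_add\<close>)

text \<open>The permutohedron lies in one hyperplane orthogonal to the axis. Hence the mean of a
  prism point depends on its segment coordinate alone.\<close>

lemma permutohedron_sum:
  assumes "x \<in> permutohedron d"
  shows "(\<Sum>i = 1..d + 1. Poly_Mapping.lookup x i) = real (d + 1) * (real d + 2) / 2"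
  using assms
proof (induction rule: permutohedron_induct)
  case (vertex x p)
  have "(\<Sum>i = 1..d + 1. Poly_Mapping.lookup x i) = (\<Sum>i = 1..d + 1. real (p i))"
    using vertex by (intro sum.cong) auto
  also have "\<dots> = (\<Sum>i = 1..d + 1. real i)"
    by (rule sum.reindex_bij_betw, rule permutes_imp_bij[OF vertex(1)])
  also have "\<dots> = real (d + 1) * (real d + 2) / 2"
    by (induction d) (auto simp: field_simps)
  finally show ?case .
next
  case (convex x y u v)
  have "(\<Sum>i = 1..d + 1. Poly_Mapping.lookup (u *\<^sub>R x + v *\<^sub>R y) i)
      = u * (\<Sum>i = 1..d + 1. Poly_Mapping.lookup x i) + v * (\<Sum>i = 1..d + 1. Poly_Mapping.lookup y i)"
    by (simp only: lookup_add lookup_scaleR sum.distrib sum_distrib_left real_scaleR_def)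
  also have "\<dots> = (u + v) * (real (d + 1) * (real d + 2) / 2)"
    unfolding convex.IH distrib_right ..
  finally show ?case by (simp add: convex)
qed

lemma block_cell_convex:
  assumes "x \<in> block_cell m" "y \<in> block_cell m" "0 \<le> u" "0 \<le> v" "u + v = 1"
  shows "(\<lambda>p. u * x p + v * y p) \<in> block_cell m"
  unfolding block_cell_def
proof safe
  fix s q
  let ?t = "coset_vector m s q"
  have "2 * (\<Sum>p<m. (u * x p + v * y p) * ?t p) = u * (2 * (\<Sum>p<m. x p * ?t p)) + v * (2 * (\<Sum>p<m. y p * ?t p))"
    by (simp add: sum_distrib_left sum.distrib algebra_simps)
  also have "\<dots> \<le> u * (\<Sum>p<m. (?t p)\<^sup>2) + v * (\<Sum>p<m. (?t p)\<^sup>2)"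
    using assms by (intro add_mono mult_left_mono) (auto simp: block_cell_def)
  also have "\<dots> = (\<Sum>p<m. (?t p)\<^sup>2)"
    using assms(5) by (simp flip: distrib_right)
  finally show "2 * (\<Sum>p<m. (u * x p + v * y p) * ?t p) \<le> (\<Sum>p<m. (?t p)\<^sup>2)" .
qed

text \<open>Positions on a cycle count from 0, whereas the permutohedron and the symmetric group use
  1,...,m. This lemma and the next translate between the two.\<close>

lemma permutes_shift_down:
  assumes "P permutes {1..m}"
  shows "(\<lambda>p. if p < m then P (Suc p) - 1 else p) permutes {..<m}"
proof (rule bij_imp_permutes)
  have P: "P (Suc p) \<in> {1..m}" if "p < m" for p
    using that permutes_in_image[OF assms, of "Suc p"] by auto
  let ?f = "\<lambda>p. if p < m then P (Suc p) - 1 else p"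
  have "inj_on ?f {..<m}"
  proof (rule inj_onI)
    fix p q assume pq: "p \<in> {..<m}" "q \<in> {..<m}" "?f p = ?f q"
    then have "P (Suc p) = P (Suc q)" using P[of p] P[of q] by auto
    then show "p = q" using permutes_inj[OF assms] by (simp add: inj_eq)
  qed
  moreover have "?f ` {..<m} \<subseteq> {..<m}"
  proof safe
    fix p assume "p < m"
    then show "?f p < m" using P[of p] by auto
  qed
  ultimately show "bij_betw ?f {..<m} {..<m}"
    unfolding bij_betw_def using endo_inj_surj[OF finite_lessThan] by blast
qed auto

lemma permutes_shift_up:
  assumes "P permutes {..<m}"
  shows "(\<lambda>i. if i \<in> {1..m} then Suc (P (i - 1)) else i) permutes {1..m}"
proof (rule bij_imp_permutes)
  have P: "P (i - 1) < m" if "i \<in> {1..m}" for i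
    using that permutes_in_image[OF assms, of "i - 1"] by auto
  let ?f = "\<lambda>i. if i \<in> {1..m} then Suc (P (i - 1)) else i"
  have "inj_on ?f {1..m}"
  proof (rule inj_onI)
    fix p q assume pq: "p \<in> {1..m}" "q \<in> {1..m}" "?f p = ?f q"
    then have "P (p - 1) = P (q - 1)" by simp
    then have "p - 1 = q - 1" using permutes_inj[OF assms] by (simp add: inj_eq)
    moreover have "1 \<le> p" "1 \<le> q" using pq(1,2) by auto
    ultimately show "p = q" by linarith
  qed
  moreover have "?f ` {1..m} \<subseteq> {1..m}"
  proof
    fix x assume "x \<in> ?f ` {1..m}"
    then obtain i where i: "i \<in> {1..m}" "x = ?f i" by blast
    then show "x \<in> {1..m}" using P[of i] by auto
  qed
  ultimately show "bij_betw ?f {1..m} {1..m}"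
    unfolding bij_betw_def using endo_inj_surj[OF finite_atLeastAtMost] by blast
qed auto

text \<open>Over a vertex of the base, the point of mean \<xi> divides the edge joining the two
  corresponding prism vertices, of means -1/2 and 1/2, with weights 1/2 - \<xi> and 1/2 + \<xi>.
  Convexity does the rest.\<close>

lemma prism_in_block_cell:
  assumes y: "y \<in> permutohedron (m - 1)" and m: "0 < m" and \<xi>: "\<bar>\<xi>\<bar> \<le> 1 / 2"
  shows "(\<lambda>p. Poly_Mapping.lookup y (Suc p) - (real m + 1) / 2 + \<xi>) \<in> block_cell m"
  using y
proof (induction rule: permutohedron_induct)
  case (vertex y P)
  have P: "P permutes {1..m}" using vertex(1) m by simp
  define \<pi> where "\<pi> p = (if p < m then P (Suc p) - 1 else p)" for p
  have \<pi>: "\<pi> permutes {..<m}" unfolding \<pi>_def using P by (rule permutes_shift_down)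
  have "(\<lambda>p. (1 / 2 - \<xi>) * prism_vertex m \<pi> 0 p + (1 / 2 + \<xi>) * prism_vertex m \<pi> 1 p) \<in> block_cell m"
    using \<xi> by (intro block_cell_convex prism_vertex_in_block_cell \<pi>) auto
  moreover have "Poly_Mapping.lookup y (Suc p) - (real m + 1) / 2 + \<xi> =
      (1 / 2 - \<xi>) * prism_vertex m \<pi> 0 p + (1 / 2 + \<xi>) * prism_vertex m \<pi> 1 p" if "p < m" for p
  proof -
    have "P (Suc p) \<ge> 1" using permutes_in_image[OF P, of "Suc p"] that by auto
    then have "real (P (Suc p)) = real (\<pi> p) + 1" using that by (simp add: \<pi>_def)
    then have "Poly_Mapping.lookup y (Suc p) = real (\<pi> p) + 1" using vertex(2)[of "Suc p"] that m by auto
    then show ?thesis by (simp add: prism_vertex_def field_simps)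
  qed
  ultimately show ?case by (simp add: block_cell_def)
next
  case (convex x y u v)
  from block_cell_convex[OF convex.IH convex.hyps]
  have "(\<lambda>p. u * (Poly_Mapping.lookup x (Suc p) - (real m + 1) / 2 + \<xi>) +
      v * (Poly_Mapping.lookup y (Suc p) - (real m + 1) / 2 + \<xi>)) \<in> block_cell m" .
  moreover have "u * (a - c + \<xi>) + v * (b - c + \<xi>) = u * a + v * b - c + \<xi>" for a b c
  proof -
    have "u * (a - c + \<xi>) + v * (b - c + \<xi>) = u * a + v * b + (u + v) * (\<xi> - c)"
      by (simp add: algebra_simps)
    then show ?thesis using convex.hyps by simp
  qed
  ultimately show ?case by (simp add: lookup_add)
qed

section \<open>The isometry from the cell to the product of prisms\<close>

context cycle_labelling
begin

definition block_mean :: "real ^ 'n \<Rightarrow> nat \<Rightarrow> real" where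
  "block_mean x j = (\<Sum>p<ms ! j. x $ label j p) / real (ms ! j)"

definition base_point :: "real ^ 'n \<Rightarrow> nat \<Rightarrow> nat \<Rightarrow>\<^sub>0 real" where
  "base_point x j = Abs_poly_mapping (\<lambda>i. if i \<in> {1..ms ! j}
     then x $ label j (i - 1) - block_mean x j + (real (ms ! j) + 1) / 2 else 0)"

text \<open>Orthogonal splitting of each block along (1,...,1). That vector has length sqrt m, which
  gives the scale of the segment; adding 1/2 moves the means from [-1/2, 1/2] to [0, 1]. The base is
  recentred at (m + 1)/2, the mean of 1,...,m.\<close>

definition to_prisms :: "real ^ 'n \<Rightarrow> nat \<Rightarrow> (nat \<Rightarrow>\<^sub>0 real) \<times> real" where
  "to_prisms x = (\<lambda>j\<in>{..<length ms}. (base_point x j, sqrt (real (ms ! j)) * (block_mean x j + 1 / 2)))"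

lemma lookup_base_point:
  "Poly_Mapping.lookup (base_point x j) i = (if i \<in> {1..ms ! j}
     then x $ label j (i - 1) - block_mean x j + (real (ms ! j) + 1) / 2 else 0)"
proof -
  let ?f = "\<lambda>i. if i \<in> {1..ms ! j} then x $ label j (i - 1) - block_mean x j + (real (ms ! j) + 1) / 2 else 0"
  have "finite {i. ?f i \<noteq> 0}" by (rule finite_subset[of _ "{1..ms ! j}"]) auto
  then show ?thesis unfolding base_point_def by (subst lookup_Abs_poly_mapping) auto
qed

text \<open>Pythagoras in each block: removing the mean \<mu> of the difference costs m \<mu>^2,
  exactly the square contributed by the segment coordinate.\<close>

lemma dist_to_prisms: "prism_product_dist ms (to_prisms x) (to_prisms y) = dist x y"
proof -
  have "(\<Sum>i = 1..ms ! j. (Poly_Mapping.lookup (base_point x j) i - Poly_Mapping.lookup (base_point y j) i)\<^sup>2)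
      + (sqrt (real (ms ! j)) * (block_mean x j + 1 / 2) - sqrt (real (ms ! j)) * (block_mean y j + 1 / 2))\<^sup>2
      = (\<Sum>p<ms ! j. ((x - y) $ label j p)\<^sup>2)" if j: "j < length ms" for j
  proof -
    let ?m = "real (ms ! j)"
    define z where "z p = (x - y) $ label j p" for p
    define \<mu> where "\<mu> = block_mean x j - block_mean y j"
    have \<mu>: "?m * \<mu> = (\<Sum>p<ms ! j. z p)"
      using length_pos[OF j] by (simp add: \<mu>_def block_mean_def z_def sum_subtractf right_diff_distrib)
    have "(\<Sum>i = 1..ms ! j. (Poly_Mapping.lookup (base_point x j) i - Poly_Mapping.lookup (base_point y j) i)\<^sup>2)
        = (\<Sum>p<ms ! j. (z p - \<mu>)\<^sup>2)"
      unfolding One_nat_def sum.atLeast1_atMost_eq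
      by (intro sum.cong) (auto simp: lookup_base_point z_def \<mu>_def algebra_simps)
    also have "\<dots> = (\<Sum>p<ms ! j. (z p)\<^sup>2) - 2 * \<mu> * (\<Sum>p<ms ! j. z p) + ?m * \<mu>\<^sup>2"
      by (simp add: power2_diff sum.distrib sum_subtractf sum_distrib_left mult.commute mult.left_commute)
    also have "\<dots> = (\<Sum>p<ms ! j. (z p)\<^sup>2) - ?m * \<mu>\<^sup>2"
      by (simp add: \<mu>[symmetric] power2_eq_square)
    finally have "(\<Sum>i = 1..ms ! j. (Poly_Mapping.lookup (base_point x j) i - Poly_Mapping.lookup (base_point y j) i)\<^sup>2)
        = (\<Sum>p<ms ! j. (z p)\<^sup>2) - ?m * \<mu>\<^sup>2" .
    moreover have "sqrt ?m * (block_mean x j + 1 / 2) - sqrt ?m * (block_mean y j + 1 / 2) = sqrt ?m * \<mu>"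
      by (simp add: \<mu>_def algebra_simps)
    ultimately show ?thesis by (simp add: z_def power_mult_distrib)
  qed
  then have "prism_product_dist ms (to_prisms x) (to_prisms y) = sqrt (\<Sum>j<length ms. \<Sum>p<ms ! j. ((x - y) $ label j p)\<^sup>2)"
    by (simp add: prism_product_dist_def to_prisms_def)
  also have "\<dots> = dist x y"
    by (simp add: dist_norm norm_eq_sqrt_inner inner_label power2_eq_square)
  finally show ?thesis .
qed

lemma block_mean_combination:
  "block_mean (u *\<^sub>R x + v *\<^sub>R y) j = u * block_mean x j + v * block_mean y j"
  by (simp add: block_mean_def sum.distrib sum_distrib_left add_divide_distrib)

lemma base_point_combination:
  assumes "u + v = 1"
  shows "base_point (u *\<^sub>R x + v *\<^sub>R y) j = u *\<^sub>R base_point x j + v *\<^sub>R base_point y j"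
proof (rule poly_mapping_eqI)
  fix i
  define K where "K = (real (ms ! j) + 1) / 2"
  have K: "K = u * K + v * K" using assms by (simp flip: distrib_right)
  show "Poly_Mapping.lookup (base_point (u *\<^sub>R x + v *\<^sub>R y) j) i
      = Poly_Mapping.lookup (u *\<^sub>R base_point x j + v *\<^sub>R base_point y j) i"
    unfolding lookup_base_point lookup_add lookup_scaleR block_mean_combination K_def[symmetric]
    using K by (simp add: algebra_simps)
qed

text \<open>A vertex has mean e - 1/2, so subtracting the mean erases e; recentring then leaves
  \<pi> p + 1.\<close>

lemma base_point_tile_vertex:
  assumes "w \<in> tile_vertices" "j < length ms"
  shows "base_point w j \<in> permutohedron (ms ! j - 1)"
proof -
  let ?m = "ms ! j"
  obtain \<pi> e where \<pi>: "\<pi> permutes {..<?m}" and w: "\<And>p. p < ?m \<Longrightarrow> w $ label j p = prism_vertex ?m \<pi> e p"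
    using assms unfolding tile_vertices_def by blast
  have m: "0 < ?m" using assms(2) by (rule length_pos)
  have "(\<Sum>p<?m. w $ label j p) = (\<Sum>p<?m. real (\<pi> p)) + real ?m * (real e - real ?m / 2)"
    by (simp add: w prism_vertex_def sum.distrib sum_subtractf algebra_simps)
  also have "(\<Sum>p<?m. real (\<pi> p)) = (\<Sum>p<?m. real p)"
    by (rule sum.reindex_bij_betw, rule permutes_imp_bij[OF \<pi>])
  also have "(\<Sum>p<k. real p) = real k * (real k - 1) / 2" for k
    by (induction k) (auto simp: field_simps)
  finally have mean: "block_mean w j = real e - 1 / 2"
    using m by (simp add: block_mean_def field_simps)
  define P where "P i = (if i \<in> {1..?m} then Suc (\<pi> (i - 1)) else i)" for i
  have "P permutes {1..?m}" unfolding P_def using \<pi> by (rule permutes_shift_up)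
  moreover have "Poly_Mapping.lookup (base_point w j) i = (if i \<in> {1..?m} then real (P i) else 0)" for i
  proof (cases "i \<in> {1..?m}")
    case True
    then have "w $ label j (i - 1) = prism_vertex ?m \<pi> e (i - 1)" by (intro w) auto
    with True show ?thesis
      by (simp add: lookup_base_point mean P_def prism_vertex_def field_simps)
  next
    case False
    then show ?thesis unfolding lookup_base_point by (simp only: if_False)
  qed
  ultimately show ?thesis
    unfolding permutohedron_def using m by (intro hull_inc) (auto simp del: atLeastAtMost_iff)
qed

lemma to_prisms_in_prism_product:
  assumes "x \<in> voronoi_cell tile_lattice"
  shows "to_prisms x \<in> prism_product ms (\<lambda>j. sqrt (real (ms ! j)))"
proof -
  have "base_point x j \<in> permutohedron (ms ! j - 1)" if j: "j < length ms" for j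
  proof -
    have "convex {x. base_point x j \<in> permutohedron (ms ! j - 1)}"
      unfolding convex_def by (auto simp: base_point_combination intro: convexD[OF convex_permutohedron])
    moreover have "tile_vertices \<subseteq> {x. base_point x j \<in> permutohedron (ms ! j - 1)}"
      using base_point_tile_vertex j by blast
    ultimately show ?thesis
      using assms hull_minimal unfolding voronoi_cell_tile_lattice_eq by blast
  qed
  moreover have "sqrt (real (ms ! j)) * (block_mean x j + 1 / 2) \<in> {0..sqrt (real (ms ! j))}" if j: "j < length ms" for j
  proof -
    have "\<bar>\<Sum>p<ms ! j. x $ label j p\<bar> \<le> real (ms ! j) / 2"
      using assms j by (intro block_cell_mean length_pos) (auto simp: voronoi_cell_tile_lattice_iff)
    then have "\<bar>block_mean x j\<bar> \<le> 1 / 2"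
      using length_pos[OF j] by (simp add: block_mean_def field_simps)
    then have "0 \<le> block_mean x j + 1 / 2" "block_mean x j + 1 / 2 \<le> 1" by linarith+
    then show ?thesis
      using mult_left_mono[of "block_mean x j + 1 / 2" 1 "sqrt (real (ms ! j))"] by simp
  qed
  ultimately show ?thesis by (auto simp: prism_product_def to_prisms_def simp del: atLeastAtMost_iff)
qed

lemma to_prisms_surj:
  assumes z: "z \<in> prism_product ms (\<lambda>j. sqrt (real (ms ! j)))"
  obtains x where "x \<in> voronoi_cell tile_lattice" "to_prisms x = z"
proof -
  \<comment> \<open>The mean that the preimage must have on cycle j, solved from the segment
    coordinate.\<close>
  define \<xi> where "\<xi> j = snd (z j) / sqrt (real (ms ! j)) - 1 / 2" for j
  define x where "x = from_blocks (\<lambda>j p. Poly_Mapping.lookup (fst (z j)) (Suc p) - (real (ms ! j) + 1) / 2 + \<xi> j)"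
  have zj: "fst (z j) \<in> permutohedron (ms ! j - 1)" "snd (z j) \<in> {0..sqrt (real (ms ! j))}" if "j < length ms" for j
    using PiE_mem[OF z[unfolded prism_product_def], of j] that by auto
  have x: "x \<in> voronoi_cell tile_lattice"
    unfolding voronoi_cell_tile_lattice_iff
  proof (intro allI impI)
    fix j assume j: "j < length ms"
    have "0 \<le> snd (z j) / sqrt (real (ms ! j))" "snd (z j) / sqrt (real (ms ! j)) \<le> 1"
      using zj(2)[OF j] length_pos[OF j] by (auto simp: field_simps)
    then have "\<bar>\<xi> j\<bar> \<le> 1 / 2" unfolding \<xi>_def abs_le_iff by linarith
    from prism_in_block_cell[OF zj(1)[OF j] length_pos[OF j] this]
    show "(\<lambda>p. x $ label j p) \<in> block_cell (ms ! j)"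
      using j by (simp add: block_cell_def x_def)
  qed
  have inside: "to_prisms x j = z j" if j: "j < length ms" for j
  proof -
    let ?m = "ms ! j"
    have m: "0 < ?m" using j by (rule length_pos)
    define K where "K = (real ?m + 1) / 2"
    have "(\<Sum>p<?m. Poly_Mapping.lookup (fst (z j)) (Suc p)) = real ?m * K"
      using permutohedron_sum[OF zj(1)[OF j]] m by (simp add: sum.atLeast1_atMost_eq of_nat_diff K_def field_simps)
    moreover have "(\<Sum>p<?m. x $ label j p) = (\<Sum>p<?m. Poly_Mapping.lookup (fst (z j)) (Suc p) - K + \<xi> j)"
      using j by (simp add: x_def K_def)
    ultimately have mean: "block_mean x j = \<xi> j"
      using m by (simp add: block_mean_def sum.distrib sum_subtractf)
    have "base_point x j = fst (z j)"
    proof (rule poly_mapping_eqI)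
      fix i
      show "Poly_Mapping.lookup (base_point x j) i = Poly_Mapping.lookup (fst (z j)) i"
      proof (cases "i \<in> {1..?m}")
        case True
        then have "i - 1 < ?m" "Suc (i - 1) = i" by auto
        then have "x $ label j (i - 1) = Poly_Mapping.lookup (fst (z j)) i - (real ?m + 1) / 2 + \<xi> j"
          by (simp only: x_def from_blocks_label[OF j])
        then show ?thesis unfolding lookup_base_point mean using True by (simp del: atLeastAtMost_iff)
      next
        case False
        then show ?thesis unfolding lookup_base_point
          using permutohedron_support[OF zj(1)[OF j], of i] m by (simp only: if_False) simp
      qed
    qed
    moreover have "sqrt (real ?m) * (block_mean x j + 1 / 2) = snd (z j)"
      using m by (simp add: mean \<xi>_def)
    ultimately show ?thesis using j by (simp add: to_prisms_def)
  qed
  have outside: "to_prisms x j = undefined" "z j = undefined" if "\<not> j < length ms" for j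
    using that PiE_arb[OF z[unfolded prism_product_def], of j] by (auto simp: to_prisms_def)
  have "to_prisms x = z"
  proof
    fix j show "to_prisms x j = z j" using inside outside by (cases "j < length ms") auto
  qed
  with x show ?thesis by (rule that)
qed

lemma congruent_voronoi_cell:
  "congruent_to_prism_product (voronoi_cell tile_lattice) ms (\<lambda>j. sqrt (real (ms ! j)))"
proof -
  have "inj_on to_prisms (voronoi_cell tile_lattice)"
  proof (rule inj_onI)
    fix x y assume "to_prisms x = to_prisms y"
    then have "dist x y = dist y y" by (metis dist_to_prisms)
    then show "x = y" by simp
  qed
  moreover have "to_prisms ` voronoi_cell tile_lattice = prism_product ms (\<lambda>j. sqrt (real (ms ! j)))"
  proof (intro subset_antisym image_subsetI to_prisms_in_prism_product subsetI)
    fix z assume "z \<in> prism_product ms (\<lambda>j. sqrt (real (ms ! j)))"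
    then show "z \<in> to_prisms ` voronoi_cell tile_lattice" by (rule to_prisms_surj) blast
  qed
  ultimately show ?thesis
    unfolding congruent_to_prism_product_def bij_betw_def using dist_to_prisms by blast
qed

end

section \<open>Invertible vectors\<close>

context cycle_labelling
begin

lemma perm_power_label:
  assumes j: "j < length ms" and "p < ms ! j"
  shows "perm_power \<tau> a (label j p) = label j (nat ((int p + a) mod int (ms ! j)))"
  using assms(2)
proof (induction a arbitrary: p rule: int_induct[where k = 0])
  case base
  then show ?case by simp
next
  case (step1 a)
  have "int (Suc p mod ms ! j) = (int p + 1) mod int (ms ! j)" by (simp add: zmod_int add.commute)
  then have "(int (Suc p mod ms ! j) + a) mod int (ms ! j) = (int p + (a + 1)) mod int (ms ! j)"
    by (simp add: mod_add_right_eq ac_simps)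
  then show ?case
    using step1 perm_label[OF j] length_pos[OF j]
    by (simp add: perm_power_Suc[OF permutes_bij[OF permutes]])
next
  case (step2 a)
  let ?m = "int (ms ! j)"
  \<comment> \<open>The position before p on the cycle; a step backwards is read off from
    \<open>perm_power_Suc\<close> at q.\<close>
  define q where "q = nat ((int p - 1) mod ?m)"
  have m: "0 < ?m" using length_pos[OF j] by simp
  have q: "int q = (int p - 1) mod ?m" using m by (simp add: q_def)
  then have "q < ms ! j" using m by (metis of_nat_less_iff pos_mod_bound)
  have "int (Suc q mod ms ! j) = (int q + 1) mod ?m" by (simp add: zmod_int add.commute)
  also have "\<dots> = int p" using q step2.prems by (simp add: mod_add_left_eq)
  finally have "\<tau> (label j q) = label j p" using perm_label[OF j \<open>q < ms ! j\<close>] by simp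
  then have "perm_power \<tau> (a - 1) (label j p) = perm_power \<tau> a (label j q)"
    using perm_power_Suc[OF permutes_bij[OF permutes], of "a - 1" "label j q"] by simp
  also have "\<dots> = label j (nat ((int q + a) mod ?m))" using step2.IH \<open>q < ms ! j\<close> by blast
  also have "(int q + a) mod ?m = (int p + (a - 1)) mod ?m"
    unfolding q mod_add_left_eq by (simp add: algebra_simps)
  finally show ?case .
qed

text \<open>A vector a acts by i -> \<tau>^(a_i)(i), and a product acts as the composition. A right
  inverse of a therefore yields a left inverse of its action; conversely, injectivity on a finite
  set gives a bijection.\<close>

lemma Units_twisted_monoid_iff:
  "a \<in> Units (twisted_monoid \<tau>) \<longleftrightarrow> inj (\<lambda>i. perm_power \<tau> (a $ i) i)"
proof
  note add = perm_power_add[OF permutes_bij[OF permutes]]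
  let ?act = "\<lambda>a i. perm_power \<tau> (a $ i) i"
  {
    assume "a \<in> Units (twisted_monoid \<tau>)"
    then obtain b where "(\<chi> i. a $ i + b $ ?act a i) = 0"
      by (auto simp: Units_def twisted_monoid_def)
    then have "a $ i + b $ ?act a i = 0" for i by (simp add: vec_eq_iff)
    then have "?act b (?act a i) = i" for i using add[of "a $ i" "b $ ?act a i" i] by simp
    then show "inj (?act a)" by (rule inj_on_inverseI)
  }
  assume inj: "inj (?act a)"
  then have "bij (?act a)" by (simp add: finite_UNIV_inj_surj bij_def)
  define g where "g = inv_into UNIV (?act a)"
  have g: "g (?act a i) = i" "?act a (g i) = i" for i
    using \<open>bij (?act a)\<close> inv_f_f[of "?act a" i] surj_f_inv_f[of "?act a" i] by (auto simp: g_def bij_def)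
  \<comment> \<open>Forced by a_i + b_k = 0 at k = \<open>?act a i\<close>. The action of b is then
    g, so b is an inverse on the other side too.\<close>
  define b where "b = (\<chi> i. - a $ g i)"
  have "a $ i + b $ ?act a i = 0" for i by (simp add: b_def g)
  moreover have "b $ i + a $ ?act b i = 0" for i
  proof -
    have "?act b i = perm_power \<tau> (a $ g i + - (a $ g i)) (g i)"
      unfolding add by (simp add: b_def g)
    then show ?thesis by (simp add: b_def)
  qed
  ultimately show "a \<in> Units (twisted_monoid \<tau>)"
    unfolding Units_def twisted_monoid_def by (auto simp: vec_eq_iff intro!: exI[of _ b])
qed

text \<open>The action of a on the positions of cycle j, extended by the identity so that it can be
  a permutation in the sense of \<open>permutes\<close>.\<close>

definition residue :: "int ^ 'n \<Rightarrow> nat \<Rightarrow> nat \<Rightarrow> nat" where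
  "residue a j p = (if p < ms ! j then nat ((int p + a $ label j p) mod int (ms ! j)) else p)"

lemma int_residue:
  assumes "j < length ms" "p < ms ! j"
  shows "int (residue a j p) = (int p + a $ label j p) mod int (ms ! j)"
  using assms length_pos[OF assms(1)] by (simp add: residue_def)

lemma residue_less:
  assumes "j < length ms" "p < ms ! j"
  shows "residue a j p < ms ! j"
proof -
  have "int (residue a j p) < int (ms ! j)"
    unfolding int_residue[OF assms] using length_pos[OF assms(1)] by simp
  then show ?thesis by simp
qed

lemma carrier_twisted_group_iff:
  "a \<in> carrier (twisted_group \<tau>) \<longleftrightarrow> (\<forall>j<length ms. residue a j permutes {..<ms ! j})"
proof -
  let ?act = "\<lambda>i. perm_power \<tau> (a $ i) i"
  have act: "?act (label j p) = label j (residue a j p)" if "j < length ms" "p < ms ! j" for j p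
    using that by (simp add: perm_power_label residue_def)
  have "inj ?act \<longleftrightarrow> (\<forall>j<length ms. residue a j permutes {..<ms ! j})"
  proof safe
    fix j assume inj: "inj ?act" and j: "j < length ms"
    have "inj_on (residue a j) {..<ms ! j}"
    proof (rule inj_onI)
      fix p q assume pq: "p \<in> {..<ms ! j}" "q \<in> {..<ms ! j}" "residue a j p = residue a j q"
      then have "?act (label j p) = ?act (label j q)" using j by (simp only: act lessThan_iff)
      then have "label j p = label j q" using inj by (rule injD[rotated])
      then show "p = q" using pq j by (simp add: label_eq_iff)
    qed
    moreover have "residue a j ` {..<ms ! j} \<subseteq> {..<ms ! j}"
      using residue_less[OF j] by auto
    ultimately have "bij_betw (residue a j) {..<ms ! j} {..<ms ! j}"
      unfolding bij_betw_def using endo_inj_surj[OF finite_lessThan] by blast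
    then show "residue a j permutes {..<ms ! j}"
      by (rule bij_imp_permutes) (simp add: residue_def)
  next
    assume perm: "\<forall>j<length ms. residue a j permutes {..<ms ! j}"
    show "inj ?act"
    proof (rule injI)
      fix i i' assume eq: "?act i = ?act i'"
      obtain j p where i: "i = label j p" "j < length ms" "p < ms ! j" by (rule label_cases)
      obtain j' p' where i': "i' = label j' p'" "j' < length ms" "p' < ms ! j'" by (rule label_cases)
      have "label j (residue a j p) = label j' (residue a j' p')"
        using eq i i' by (simp only: act)
      then have "j = j'" "residue a j p = residue a j p'"
        using label_eq_iff[OF i(2) residue_less[OF i(2,3)] i'(2) residue_less[OF i'(2,3)]] by auto
      moreover have "inj (residue a j)" using perm i(2) permutes_inj by blast
      ultimately show "i = i'" using i i' by (simp add: inj_eq)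
    qed
  qed
  then show ?thesis by (simp add: twisted_group_def units_of_def Units_twisted_monoid_iff)
qed

text \<open>The term m/2 undoes the centring of the vertices; -p appears because invertibility
  concerns p + a_p rather than a_p.\<close>

definition tile_offset :: "real ^ 'n" where
  "tile_offset = from_blocks (\<lambda>j p. real (ms ! j) / 2 - real p)"

lemma real_vec_carrier:
  "real_vec ` carrier (twisted_group \<tau>) = tessellation_vertices (translates (voronoi_cell tile_lattice) ((+) tile_offset ` tile_lattice))"
proof -
  have "tessellation_vertices (translates (voronoi_cell tile_lattice) ((+) tile_offset ` tile_lattice))
      = {v. \<exists>t\<in>tile_lattice. \<exists>w\<in>tile_vertices. v = tile_offset + t + w}"
  proof -
    have "v extreme_point_of (+) (tile_offset + t) ` voronoi_cell tile_lattice \<longleftrightarrow> (\<exists>w\<in>tile_vertices. v = tile_offset + t + w)" for v t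
      using extreme_point_of_translation_eq[of "tile_offset + t" "v - (tile_offset + t)" "voronoi_cell tile_lattice"]
      by (simp add: extreme_point_of_cell_iff) (metis add_diff_cancel_left' add_diff_eq diff_add_cancel)
    then show ?thesis by (auto simp: tessellation_vertices_def translates_def)
  qed
  moreover have "\<exists>t\<in>tile_lattice. \<exists>w\<in>tile_vertices. real_vec a = tile_offset + t + w"
    if a: "a \<in> carrier (twisted_group \<tau>)" for a
  proof -
    \<comment> \<open>Division of p + a_p by m: the quotients give the lattice vector, the
      remainders a vertex of the base e = 0.\<close>
    define q where "q j p = (int p + a $ label j p) div int (ms ! j)" for j p
    define t :: "real ^ 'n" where "t = from_blocks (\<lambda>j. coset_vector (ms ! j) 0 (q j))"
    define w :: "real ^ 'n" where "w = from_blocks (\<lambda>j. prism_vertex (ms ! j) (residue a j) 0)"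
    have "t \<in> tile_lattice"
      unfolding tile_lattice_def t_def by (intro CollectI exI[of _ "\<lambda>_. 0"] exI[of _ q]) simp
    moreover have "w \<in> tile_vertices"
      using a unfolding tile_vertices_def w_def carrier_twisted_group_iff
      by (intro CollectI exI[of _ "residue a"] exI[of _ "\<lambda>_. 0"]) simp
    moreover have "real_vec a = tile_offset + t + w"
      unfolding vec_eq_iff
    proof
      fix i
      obtain j p where i: "i = label j p" "j < length ms" "p < ms ! j" by (rule label_cases)
      have "int p + a $ label j p = int (ms ! j) * q j p + int (residue a j p)"
        unfolding int_residue[OF i(2,3)] q_def by simp
      then have "real_of_int (int p + a $ label j p) = real_of_int (int (ms ! j) * q j p + int (residue a j p))"
        by simp
      then show "real_vec a $ i = (tile_offset + t + w) $ i"
        using i by (simp add: real_vec_def tile_offset_def t_def w_def coset_vector_def prism_vertex_def)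
    qed
    ultimately show ?thesis by blast
  qed
  moreover have "tile_offset + t + w \<in> real_vec ` carrier (twisted_group \<tau>)"
    if tw: "t \<in> tile_lattice" "w \<in> tile_vertices" for t w
  proof -
    obtain s q where t: "\<And>j p. j < length ms \<Longrightarrow> p < ms ! j \<Longrightarrow> t $ label j p = coset_vector (ms ! j) (s j) (q j) p"
      using tw(1) unfolding tile_lattice_def by blast
    obtain \<pi> e where \<pi>: "\<And>j. j < length ms \<Longrightarrow> \<pi> j permutes {..<ms ! j}"
      and w: "\<And>j p. j < length ms \<Longrightarrow> p < ms ! j \<Longrightarrow> w $ label j p = prism_vertex (ms ! j) (\<pi> j) (e j) p"
      using tw(2) unfolding tile_vertices_def by blast
    define a :: "int ^ 'n" where
      "a = from_blocks (\<lambda>j p. s j + int (ms ! j) * q j p + int (\<pi> j p) + int (e j) - int p)"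
    have "real_vec a = tile_offset + t + w"
      unfolding vec_eq_iff
    proof
      fix i
      obtain j p where "i = label j p" "j < length ms" "p < ms ! j" by (rule label_cases)
      then show "real_vec a $ i = (tile_offset + t + w) $ i"
        by (simp add: real_vec_def tile_offset_def a_def t w coset_vector_def prism_vertex_def)
    qed
    moreover have "residue a j permutes {..<ms ! j}" if j: "j < length ms" for j
    proof (rule bij_imp_permutes)
      \<comment> \<open>Modulo m, p + a_p is \<pi> p shifted by the constant s + e, so both bases
        produce complete residue systems.\<close>
      have "residue a j p = nat ((int (\<pi> j p) - (- s j - int (e j))) mod int (ms ! j))" if p: "p < ms ! j" for p
      proof -
        have "int p + a $ label j p = (int (\<pi> j p) - (- s j - int (e j))) + int (ms ! j) * q j p"
          using j p by (simp add: a_def)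
        then show ?thesis using p by (simp only: residue_def if_True mod_mult_self2)
      qed
      then show "bij_betw (residue a j) {..<ms ! j} {..<ms ! j}"
        by (intro bij_betw_cong[THEN iffD1, OF _ mod_shift_permutes[OF \<pi>[OF j]]]) simp
    qed (simp add: residue_def)
    ultimately show ?thesis
      unfolding carrier_twisted_group_iff[symmetric] by (metis carrier_twisted_group_iff imageI)
  qed
  ultimately show ?thesis
    by (intro subset_antisym subsetI) (auto simp: image_iff)
qed

section \<open>The isomorphism with the product of semidirect products\<close>

definition shifted_residue :: "int ^ 'n \<Rightarrow> nat \<Rightarrow> nat \<Rightarrow> nat" where
  "shifted_residue a j = (\<lambda>i. if i \<in> {1..ms ! j} then Suc (residue a j (i - 1)) else i)"

definition to_semidirect :: "int ^ 'n \<Rightarrow> nat \<Rightarrow> (nat \<Rightarrow> int) \<times> (nat \<Rightarrow> nat)" where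
  "to_semidirect a = (\<lambda>j\<in>{..<length ms}.
     (\<lambda>i\<in>{1..ms ! j}. - ((int (i - 1) + a $ label j (i - 1)) div int (ms ! j)),
      inv_into UNIV (shifted_residue a j)))"

lemma shifted_residue_permutes:
  assumes "a \<in> carrier (twisted_group \<tau>)" "j < length ms"
  shows "shifted_residue a j permutes {1..ms ! j}"
  unfolding shifted_residue_def
  using assms by (intro permutes_shift_up) (simp add: carrier_twisted_group_iff)

lemma mult_twisted_group:
  "(a \<otimes>\<^bsub>twisted_group \<tau>\<^esub> b) $ i = a $ i + b $ perm_power \<tau> (a $ i) i"
  by (simp add: twisted_group_def units_of_def twisted_monoid_def)

lemma mult_label:
  assumes "j < length ms" "p < ms ! j"
  shows "(a \<otimes>\<^bsub>twisted_group \<tau>\<^esub> b) $ label j p = a $ label j p + b $ label j (residue a j p)"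
  using assms by (simp add: mult_twisted_group perm_power_label residue_def)

text \<open>With r the residue of p + a_p, the number p + (a*b)_p equals r + b_r plus m times the
  quotient for a. Quotients thus obey a cocycle rule twisted by the residue permutation.\<close>

lemma block_quotient_mult:
  assumes "j < length ms" "p < ms ! j"
  shows "(int p + (a \<otimes>\<^bsub>twisted_group \<tau>\<^esub> b) $ label j p) div int (ms ! j) =
      (int p + a $ label j p) div int (ms ! j) +
      (int (residue a j p) + b $ label j (residue a j p)) div int (ms ! j)"
    and "residue (a \<otimes>\<^bsub>twisted_group \<tau>\<^esub> b) j p = residue b j (residue a j p)"
proof -
  let ?m = "int (ms ! j)" and ?b = "b $ label j (residue a j p)"
  have m: "?m \<noteq> 0" using length_pos[OF assms(1)] by simp
  have eq: "int p + (a \<otimes>\<^bsub>twisted_group \<tau>\<^esub> b) $ label j p =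
      (int (residue a j p) + ?b) + ?m * ((int p + a $ label j p) div ?m)"
    unfolding int_residue[OF assms] mult_label[OF assms]
    using mult_div_mod_eq[of ?m "int p + a $ label j p"] by linarith
  show "(int p + (a \<otimes>\<^bsub>twisted_group \<tau>\<^esub> b) $ label j p) div ?m =
      (int p + a $ label j p) div ?m + (int (residue a j p) + ?b) div ?m"
    unfolding eq using m by simp
  have "int (residue (a \<otimes>\<^bsub>twisted_group \<tau>\<^esub> b) j p) = int (residue b j (residue a j p))"
    unfolding int_residue[OF assms] int_residue[OF assms(1) residue_less[OF assms]] eq by (simp add: mod_add_left_eq)
  then show "residue (a \<otimes>\<^bsub>twisted_group \<tau>\<^esub> b) j p = residue b j (residue a j p)" by simp
qed

lemma shifted_residue_mult:
  assumes "j < length ms"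
  shows "shifted_residue (a \<otimes>\<^bsub>twisted_group \<tau>\<^esub> b) j = shifted_residue b j \<circ> shifted_residue a j"
proof
  fix i
  show "shifted_residue (a \<otimes>\<^bsub>twisted_group \<tau>\<^esub> b) j i = (shifted_residue b j \<circ> shifted_residue a j) i"
  proof (cases "i \<in> {1..ms ! j}")
    case True
    then have "i - 1 < ms ! j" by auto
    with True show ?thesis
      using block_quotient_mult(2)[OF assms, of "i - 1" a b] residue_less[OF assms, of "i - 1" a]
      by (simp add: shifted_residue_def)
  next
    case False
    then show ?thesis unfolding shifted_residue_def comp_def by (simp only: if_False)
  qed
qed

text \<open>\<open>permute_coords\<close> composes with the inverse of its permutation. Applied to
  the inverse residue permutation of a, it composes with that permutation itself, as the cocycle
  rule for the quotients demands.\<close>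

lemma to_semidirect_hom:
  "to_semidirect \<in> hom (twisted_group \<tau>) (product_group {..<length ms} (\<lambda>j. int_semidirect_sym (ms ! j)))"
proof (rule homI)
  fix a assume a: "a \<in> carrier (twisted_group \<tau>)"
  show "to_semidirect a \<in> carrier (product_group {..<length ms} (\<lambda>j. int_semidirect_sym (ms ! j)))"
    using permutes_inv[OF shifted_residue_permutes[OF a]]
    by (auto simp: to_semidirect_def int_semidirect_sym_def semidirect_product_def sym_group_carrier)
next
  fix a b assume a: "a \<in> carrier (twisted_group \<tau>)" and b: "b \<in> carrier (twisted_group \<tau>)"
  have "to_semidirect (a \<otimes>\<^bsub>twisted_group \<tau>\<^esub> b) j = to_semidirect a j \<otimes>\<^bsub>int_semidirect_sym (ms ! j)\<^esub> to_semidirect b j"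
    if j: "j < length ms" for j
  proof -
    let ?\<sigma> = "shifted_residue a j"
    have bij: "bij ?\<sigma>" "bij (shifted_residue b j)"
      using permutes_bij shifted_residue_permutes a b j by blast+
    have "inv_into UNIV (shifted_residue (a \<otimes>\<^bsub>twisted_group \<tau>\<^esub> b) j) =
        inv_into UNIV ?\<sigma> \<circ> inv_into UNIV (shifted_residue b j)"
      unfolding shifted_residue_mult[OF j] using bij by (rule o_inv_distrib[OF _ _, rotated])
    moreover have "- ((int (i - 1) + (a \<otimes>\<^bsub>twisted_group \<tau>\<^esub> b) $ label j (i - 1)) div int (ms ! j)) =
        - ((int (i - 1) + a $ label j (i - 1)) div int (ms ! j)) +
        - ((int (?\<sigma> i - 1) + b $ label j (?\<sigma> i - 1)) div int (ms ! j))"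
      if i: "i \<in> {1..ms ! j}" for i
    proof -
      have "i - 1 < ms ! j" using i by auto
      moreover have "?\<sigma> i - 1 = residue a j (i - 1)" using i by (simp add: shifted_residue_def)
      ultimately show ?thesis using block_quotient_mult(1)[OF j, of "i - 1" a b] by simp
    qed
    moreover have "?\<sigma> i \<in> {1..ms ! j}" if "i \<in> {1..ms ! j}" for i
      using permutes_in_image[OF shifted_residue_permutes[OF a j]] that by blast
    ultimately show ?thesis
      using j bij
      by (auto simp: to_semidirect_def int_semidirect_sym_def semidirect_product_def sym_group_mult
          permute_coords_def inv_inv_eq restrict_def fun_eq_iff simp del: atLeastAtMost_iff)
  qed
  then show "to_semidirect (a \<otimes>\<^bsub>twisted_group \<tau>\<^esub> b) =
      to_semidirect a \<otimes>\<^bsub>product_group {..<length ms} (\<lambda>j. int_semidirect_sym (ms ! j))\<^esub> to_semidirect b"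
    by (auto simp: fun_eq_iff restrict_def to_semidirect_def)
qed

lemma to_semidirect_inj: "inj_on to_semidirect (carrier (twisted_group \<tau>))"
proof (rule inj_onI)
  fix a b assume a: "a \<in> carrier (twisted_group \<tau>)" and b: "b \<in> carrier (twisted_group \<tau>)"
    and eq: "to_semidirect a = to_semidirect b"
  show "a = b"
    unfolding vec_eq_iff
  proof
    fix i
    obtain j p where i: "i = label j p" "j < length ms" "p < ms ! j" by (rule label_cases)
    let ?m = "int (ms ! j)"
    have eqj: "fst (to_semidirect a j) (Suc p) = fst (to_semidirect b j) (Suc p)"
      "snd (to_semidirect a j) = snd (to_semidirect b j)" using eq by simp_all
    have "(int p + a $ i) div ?m = (int p + b $ i) div ?m"
      using eqj(1) i by (simp add: to_semidirect_def)
    moreover have "shifted_residue a j = shifted_residue b j"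
    proof -
      have "inv_into UNIV (shifted_residue a j) = inv_into UNIV (shifted_residue b j)"
        using eqj(2) i by (simp add: to_semidirect_def)
      then show ?thesis
        using shifted_residue_permutes[OF a i(2)] shifted_residue_permutes[OF b i(2)]
        by (metis inv_inv_eq permutes_bij)
    qed
    then have "shifted_residue a j (Suc p) = shifted_residue b j (Suc p)" by simp
    then have "residue a j p = residue b j p" using i by (simp add: shifted_residue_def)
    then have "(int p + a $ i) mod ?m = (int p + b $ i) mod ?m"
      using int_residue[OF i(2,3), of a] int_residue[OF i(2,3), of b] i by simp
    ultimately have "int p + a $ i = int p + b $ i" by (metis mult_div_mod_eq)
    then show "a $ i = b $ i" by simp
  qed
qed

lemma to_semidirect_surj:
  assumes z: "z \<in> carrier (product_group {..<length ms} (\<lambda>j. int_semidirect_sym (ms ! j)))"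
  shows "z \<in> to_semidirect ` carrier (twisted_group \<tau>)"
proof -
  have zj: "fst (z j) \<in> extensional {1..ms ! j}" "snd (z j) permutes {1..ms ! j}" if "j < length ms" for j
  proof -
    have "z j \<in> carrier (int_semidirect_sym (ms ! j))" using z that by auto
    then show "fst (z j) \<in> extensional {1..ms ! j}" "snd (z j) permutes {1..ms ! j}"
      by (auto simp: int_semidirect_sym_def semidirect_product_def sym_group_carrier PiE_def)
  qed
  define \<rho> where "\<rho> j = inv_into UNIV (snd (z j))" for j
  have \<rho>: "\<rho> j permutes {1..ms ! j}" if "j < length ms" for j
    unfolding \<rho>_def using zj(2)[OF that] by (rule permutes_inv)
  \<comment> \<open>Solved from p + a_p = m * quotient + remainder, with quotient
    \<open>- fst (z j) (Suc p)\<close> and remainder \<rho> - 1, counted from 0.\<close>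
  define a :: "int ^ 'n" where
    "a = from_blocks (\<lambda>j p. int (\<rho> j (Suc p)) - 1 - int (ms ! j) * fst (z j) (Suc p) - int p)"
  have divmod: "(int p + a $ label j p) div int (ms ! j) = - fst (z j) (Suc p)"
    "Suc (residue a j p) = \<rho> j (Suc p)" if j: "j < length ms" and p: "p < ms ! j" for j p
  proof -
    let ?m = "int (ms ! j)" and ?r = "int (\<rho> j (Suc p)) - 1"
    have "\<rho> j (Suc p) \<in> {1..ms ! j}"
      using permutes_in_image[OF \<rho>[OF j], of "Suc p"] p by simp
    then have r: "0 \<le> ?r" "?r < ?m" by auto
    have eq: "int p + a $ label j p = ?r + ?m * (- fst (z j) (Suc p))"
      using j p by (simp add: a_def)
    show "(int p + a $ label j p) div ?m = - fst (z j) (Suc p)"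
      unfolding eq using r by (subst div_mult_self2) auto
    have "int (residue a j p) = ?r"
      unfolding int_residue[OF j p] eq using r by (subst mod_mult_self2) simp
    then show "Suc (residue a j p) = \<rho> j (Suc p)" by simp
  qed
  have shifted: "shifted_residue a j = \<rho> j" if j: "j < length ms" for j
  proof
    fix i show "shifted_residue a j i = \<rho> j i"
    proof (cases "i \<in> {1..ms ! j}")
      case True
      then have "i - 1 < ms ! j" "Suc (i - 1) = i" by auto
      then show ?thesis using divmod(2)[OF j, of "i - 1"] True by (simp only: shifted_residue_def if_True)
    next
      case False
      then show ?thesis unfolding shifted_residue_def using permutes_not_in[OF \<rho>[OF j] False] by (simp only: if_False)
    qed
  qed
  have "residue a j permutes {..<ms ! j}" if j: "j < length ms" for j
  proof -
    have "inj_on (residue a j) {..<ms ! j}"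
    proof (rule inj_onI)
      fix p q assume "p \<in> {..<ms ! j}" "q \<in> {..<ms ! j}" "residue a j p = residue a j q"
      then have "\<rho> j (Suc p) = \<rho> j (Suc q)" using divmod(2)[OF j] by (metis lessThan_iff)
      then show "p = q" using permutes_inj[OF \<rho>[OF j]] by (simp add: inj_eq)
    qed
    moreover have "residue a j ` {..<ms ! j} \<subseteq> {..<ms ! j}" using residue_less[OF j] by auto
    ultimately have "bij_betw (residue a j) {..<ms ! j} {..<ms ! j}"
      unfolding bij_betw_def using endo_inj_surj[OF finite_lessThan] by blast
    then show ?thesis by (rule bij_imp_permutes) (simp add: residue_def)
  qed
  then have "a \<in> carrier (twisted_group \<tau>)" by (simp add: carrier_twisted_group_iff)
  moreover have "to_semidirect a j = z j" for j
  proof (cases "j < length ms")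
    case True
    have "inv_into UNIV (\<rho> j) = snd (z j)"
      unfolding \<rho>_def using permutes_bij[OF zj(2)[OF True]] by (rule inv_inv_eq)
    moreover have "(\<lambda>i\<in>{1..ms ! j}. - ((int (i - 1) + a $ label j (i - 1)) div int (ms ! j))) = fst (z j)"
    proof
      fix i
      show "(\<lambda>i\<in>{1..ms ! j}. - ((int (i - 1) + a $ label j (i - 1)) div int (ms ! j))) i = fst (z j) i"
      proof (cases "i \<in> {1..ms ! j}")
        case i: True
        then have "i - 1 < ms ! j" "Suc (i - 1) = i" by auto
        then show ?thesis using divmod(1)[OF True, of "i - 1"] i by (simp only: restrict_apply if_True)
      next
        case False
        then show ?thesis using extensional_arb[OF zj(1)[OF True] False] by (simp only: restrict_apply if_False)
      qed
    qed
    ultimately show ?thesis using True by (simp add: to_semidirect_def shifted prod_eq_iff)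
  next
    case False
    then show ?thesis using z PiE_arb[of z "{..<length ms}" _ j] by (simp add: to_semidirect_def)
  qed
  then have "z = to_semidirect a" by (simp add: fun_eq_iff)
  ultimately show ?thesis by blast
qed

lemma twisted_group_iso:
  "twisted_group \<tau> \<cong> product_group {..<length ms} (\<lambda>j. int_semidirect_sym (ms ! j))"
proof (rule is_isoI, rule isoI)
  show "bij_betw to_semidirect (carrier (twisted_group \<tau>))
      (carrier (product_group {..<length ms} (\<lambda>j. int_semidirect_sym (ms ! j))))"
    unfolding bij_betw_def using to_semidirect_inj to_semidirect_surj to_semidirect_hom
    by (auto simp: hom_def simp del: carrier_product_group)
qed (rule to_semidirect_hom)

lemma tessellation_tile_lattice:
  "tessellation (translates (voronoi_cell tile_lattice) ((+) tile_offset ` tile_lattice))"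
  using tile_lattice_diff zero_in_tile_lattice finite_tile_lattice_cball by (intro tessellation_voronoi_cell) auto

lemma polytope_voronoi_cell: "polytope (voronoi_cell tile_lattice)"
  unfolding voronoi_cell_tile_lattice_eq using finite_tile_vertices by (auto simp: polytope_def)

end

section \<open>Labelling by a cycle decomposition\<close>

lemma foldr_cycles_not_in:
  assumes "x \<notin> set (concat cs)"
  shows "foldr (\<circ>) (map cycle_of_list cs) id x = x"
  using assms by (induction cs) (auto simp: id_outside_supp)

text \<open>By disjointness, the cycles applied before that of c fix x, and those applied after it
  fix the image of x, which is still in c.\<close>

lemma foldr_cycles_in:
  assumes "distinct (concat cs)" "c \<in> set cs" "x \<in> set c"
  shows "foldr (\<circ>) (map cycle_of_list cs) id x = cycle_of_list c x"
  using assms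
proof (induction cs)
  case (Cons d cs)
  show ?case
  proof (cases "c \<in> set cs")
    case True
    have "distinct c" using Cons.prems(1) True by (auto simp: distinct_concat_iff)
    then have "cycle_of_list c x \<in> set c" using cycle_is_surj Cons.prems(3) by blast
    moreover have "set c \<inter> set d = {}" using Cons.prems(1) True by auto
    ultimately have "cycle_of_list c x \<notin> set d" by blast
    then show ?thesis using Cons True by (simp add: id_outside_supp)
  next
    case False
    then have "c = d" using Cons.prems(2) by simp
    then have "x \<notin> set (concat cs)" using Cons.prems(1,3) by auto
    moreover have "foldr (\<circ>) (map cycle_of_list (d # cs)) id x =
        cycle_of_list d (foldr (\<circ>) (map cycle_of_list cs) id x)"
      by (simp add: comp_def)
    ultimately show ?thesis using \<open>c = d\<close> foldr_cycles_not_in[of x cs] by metis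
  qed
qed simp

lemma cycle_labelling_nth:
  assumes "\<tau> permutes UNIV" and "disjoint_cycle_decomposition \<tau> cs"
  shows "cycle_labelling \<tau> (map length cs) (\<lambda>j p. cs ! j ! p)"
proof
  have cs: "[] \<notin> set cs" "distinct (concat cs)" "set (concat cs) = UNIV"
    "\<tau> = foldr (\<circ>) (map cycle_of_list cs) id"
    using assms(2) by (simp_all add: disjoint_cycle_decomposition_def)
  show "\<tau> permutes UNIV" by fact
  show "0 < map length cs ! j" if "j < length (map length cs)" for j
    using that cs(1) nth_mem[of j cs] by (auto simp del: nth_mem)
  show "\<tau> (cs ! j ! p) = cs ! j ! (Suc p mod map length cs ! j)"
    if "j < length (map length cs)" "p < map length cs ! j" for j p
  proof -
    let ?c = "cs ! j"
    have c: "?c \<in> set cs" "p < length ?c" using that by auto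
    then have "distinct ?c" using cs(2) by (simp add: distinct_concat_iff)
    \<comment> \<open>Mapping the cycle over its own list rotates the list by one place; comparing
      entries at index p gives the wrap-around.\<close>
    from arg_cong[OF cyclic_rotation[OF this, of 1], of "\<lambda>xs. xs ! p"]
    have "cycle_of_list ?c (?c ! p) = ?c ! (Suc p mod length ?c)"
      using c(2) by (simp add: nth_rotate1)
    moreover have "\<tau> (?c ! p) = cycle_of_list ?c (?c ! p)"
      unfolding cs(4) using c cs(2) by (intro foldr_cycles_in) auto
    ultimately show ?thesis using that(1) by simp
  qed
  let ?S = "SIGMA j:{..<length (map length cs)}. {..<map length cs ! j}"
  have "inj_on (\<lambda>(j, p). cs ! j ! p) ?S"
  proof (rule inj_onI, clarify)
    fix j p j' p'
    assume *: "cs ! j ! p = cs ! j' ! p'" "j < length (map length cs)" "p < map length cs ! j"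
      "j' < length (map length cs)" "p' < map length cs ! j'"
    then have len: "j < length cs" "p < length (cs ! j)" "j' < length cs" "p' < length (cs ! j')" by auto
    have "j = j'"
    proof (rule ccontr)
      assume "j \<noteq> j'"
      \<comment> \<open>Since no list is empty, distinctness of the concatenation forces different
        indices to carry different, hence disjoint, lists.\<close>
      then have "set (cs ! j) \<inter> set (cs ! j') = {}"
        using cs(1,2) len(1,3) by (metis distinct_concat_iff removeAll_id nth_eq_iff_index_eq nth_mem)
      then show False using *(1) len nth_mem by (metis disjoint_iff)
    qed
    moreover have "distinct (cs ! j)" using cs(2) len(1) by (simp add: distinct_concat_iff)
    ultimately show "j = j' \<and> p = p'" using *(1) len by (simp add: nth_eq_iff_index_eq)
  qed
  moreover have "x \<in> (\<lambda>(j, p). cs ! j ! p) ` ?S" for x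
  proof -
    have "x \<in> set (concat cs)" using cs(3) by blast
    then obtain c where "c \<in> set cs" "x \<in> set c" by auto
    then obtain j p where "j < length cs" "c = cs ! j" "p < length c" "x = c ! p"
      by (metis in_set_conv_nth)
    then show ?thesis by (intro image_eqI[of _ _ "(j, p)"]) auto
  qed
  ultimately show "bij_betw (\<lambda>(j, p). cs ! j ! p) ?S UNIV"
    unfolding bij_betw_def by blast
qed

theorem theorem2:
  fixes \<tau> :: "'n::finite \<Rightarrow> 'n" and cs :: "'n list list" and ms :: "nat list"
  assumes "\<tau> permutes UNIV"
    and "disjoint_cycle_decomposition \<tau> cs"
    and "ms = map length cs"
  shows "(\<exists>(P :: (real ^ 'n) set) (L :: (real ^ 'n) set) (l :: nat \<Rightarrow> real).
            polytope P \<and>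
            (\<forall>j<length ms. 0 < l j) \<and>
            congruent_to_prism_product P ms l \<and>
            tessellation (translates P L) \<and>
            real_vec ` carrier (twisted_group \<tau>) = tessellation_vertices (translates P L))
         \<and> twisted_group \<tau> \<cong> product_group {..<length ms} (\<lambda>j. int_semidirect_sym (ms ! j))"
proof -
  interpret cycle_labelling \<tau> ms "\<lambda>j p. cs ! j ! p"
    unfolding assms(3) using assms(1,2) by (rule cycle_labelling_nth)
  show ?thesis
    using polytope_voronoi_cell congruent_voronoi_cell tessellation_tile_lattice real_vec_carrier
      twisted_group_iso length_pos
    by (intro conjI exI[of _ "voronoi_cell tile_lattice"] exI[of _ "(+) tile_offset ` tile_lattice"]
        exI[of _ "\<lambda>j. sqrt (real (ms ! j))"]) auto
qed

end
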